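(* Let $\gamma$ be a closed geodesic on an orientable hyperbolic surface $M$, and let $l$ and $m$ be distinct geodesics in $\mathbb{H}^2$ above $\gamma$. Then the orthogonal projection of $l$ onto $m$ has length strictly less than $l(\gamma)$.
   Context: A hyperbolic surface $M$ is one whose universal cover is isometric to the hyperbolic plane $\mathbb{H}^2$, so that $M=\mathbb{H}^2/\pi_1(M)$ with $\pi_1(M)$ acting as a discrete torsion-free group of isometries (covering translations). $M$ need not be compact or of finite area. For a closed geodesic $\gamma$ on $M$, $l(\gamma)$ denotes its length, and a geodesic in $\mathbb{H}^2$ "above $\gamma$" is a complete geodesic line in $\mathbb{H}^2$ that is a component of the pre-image of $\gamma$ (a lift of $\gamma$ to a bi-infinite geodesic line). The orthogonal projection of a geodesic line onto another is its image under nearest-point projection; it is an interval of the second line. *)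

theory Defs
  imports "HOL-Analysis.Analysis" "HOL-Algebra.Bij"
begin

text \<open>The hyperbolic plane, in the upper half-plane model.\<close>

definition hplane :: "complex set" where
  "hplane = {z. Im z > 0}"

definition hdist :: "complex \<Rightarrow> complex \<Rightarrow> real" where
  "hdist z w = arcosh (1 + (cmod (z - w))\<^sup>2 / (2 * Im z * Im w))"

definition geodesic_line :: "(real \<Rightarrow> complex) \<Rightarrow> bool" where
  "geodesic_line \<sigma> \<longleftrightarrow> range \<sigma> \<subseteq> hplane \<and> (\<forall>s t. hdist (\<sigma> s) (\<sigma> t) = \<bar>s - t\<bar>)"

text \<open>A hyperbolic surface is represented by its group of covering translations \<open>\<Gamma>\<close>, so that
  the surface is \<open>hplane / \<Gamma>\<close>. Elements of \<open>BijGroup hplane\<close> are bijections of \<open>hplane\<close> that are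
  extensional (constantly \<open>undefined\<close> outside of \<open>hplane\<close>). Hence the topology of the function space,
  in which \<open>discrete\<close> is interpreted, is that of pointwise convergence on \<open>hplane\<close>; on isometries
  this is the usual (compact-open) topology.\<close>

definition hyperbolic_surface_group :: "(complex \<Rightarrow> complex) set \<Rightarrow> bool" where
  "hyperbolic_surface_group \<Gamma> \<longleftrightarrow>
     subgroup \<Gamma> (BijGroup hplane) \<and>
     (\<forall>g\<in>\<Gamma>. \<forall>z\<in>hplane. \<forall>w\<in>hplane. hdist (g z) (g w) = hdist z w) \<and>
     discrete \<Gamma> \<and>
     (\<forall>g\<in>\<Gamma>. g \<noteq> \<one>\<^bsub>BijGroup hplane\<^esub> \<longrightarrow>
        (\<forall>n::nat. n > 0 \<longrightarrow> g [^]\<^bsub>BijGroup hplane\<^esub> n \<noteq> \<one>\<^bsub>BijGroup hplane\<^esub>))"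

text \<open>The determinant of the real derivative of a map of the plane: \<open>Im (cnj u * v)\<close> is the
  determinant of the matrix with columns \<open>u\<close> and \<open>v\<close>.\<close>

definition jacobian :: "(complex \<Rightarrow> complex) \<Rightarrow> complex \<Rightarrow> real" where
  "jacobian g z = (let D = frechet_derivative g (at z) in Im (cnj (D 1) * D \<i>))"

text \<open>An orientation of \<open>hplane / \<Gamma>\<close> amounts to an orientation of \<open>hplane\<close> that is invariant
  under \<open>\<Gamma>\<close>. The latter is given by a continuous choice of signs: the sign at \<open>z\<close> says whether
  the orientation of the tangent plane at \<open>z\<close> is the standard one.\<close>

definition orientable_quotient :: "(complex \<Rightarrow> complex) set \<Rightarrow> bool" where
  "orientable_quotient \<Gamma> \<longleftrightarrow>
     (\<exists>\<omega> :: complex \<Rightarrow> real. continuous_on hplane \<omega> \<and> (\<forall>z\<in>hplane. \<omega> z \<in> {-1, 1}) \<and>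
        (\<forall>g\<in>\<Gamma>. \<forall>z\<in>hplane. \<omega> (g z) = sgn (jacobian g z) * \<omega> z))"

definition surface_proj :: "(complex \<Rightarrow> complex) set \<Rightarrow> complex \<Rightarrow> complex set" where
  "surface_proj \<Gamma> z = (\<lambda>g. g z) ` \<Gamma>"

definition surface_points :: "(complex \<Rightarrow> complex) set \<Rightarrow> complex set set" where
  "surface_points \<Gamma> = surface_proj \<Gamma> ` hplane"

definition surface_dist :: "complex set \<Rightarrow> complex set \<Rightarrow> real" where
  "surface_dist p q = Inf {hdist z w | z w. z \<in> p \<and> w \<in> q}"

text \<open>A closed geodesic of length \<open>L\<close>: a local isometry from the circle \<open>\<real> / L\<int>\<close> to the surface,
  that is, an arc-length parametrization. The period \<open>L\<close> need not be the least one, so multiply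
  traversed geodesics are included.\<close>

definition closed_geodesic ::
    "(complex \<Rightarrow> complex) set \<Rightarrow> (real \<Rightarrow> complex set) \<Rightarrow> real \<Rightarrow> bool" where
  "closed_geodesic \<Gamma> \<gamma> L \<longleftrightarrow>
     L > 0 \<and> range \<gamma> \<subseteq> surface_points \<Gamma> \<and> (\<forall>t. \<gamma> (t + L) = \<gamma> t) \<and>
     (\<forall>t. \<exists>\<epsilon>>0. \<forall>s\<in>ball t \<epsilon>. \<forall>s'\<in>ball t \<epsilon>. surface_dist (\<gamma> s) (\<gamma> s') = \<bar>s - s'\<bar>)"

definition lines_above ::
    "(complex \<Rightarrow> complex) set \<Rightarrow> (real \<Rightarrow> complex set) \<Rightarrow> complex set set" where
  "lines_above \<Gamma> \<gamma> =
     {range \<sigma> | \<sigma>. geodesic_line \<sigma> \<and> (\<forall>t. surface_proj \<Gamma> (\<sigma> t) = \<gamma> t)}"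

text \<open>The image of \<open>l\<close> under nearest-point projection to \<open>m\<close>.\<close>

definition orth_proj :: "complex set \<Rightarrow> complex set \<Rightarrow> complex set" where
  "orth_proj l m = {y \<in> m. \<exists>x\<in>l. \<forall>y'\<in>m. hdist x y \<le> hdist x y'}"

text \<open>The length of an interval (open or not, possibly unbounded) of a geodesic line is the
  distance between its end points, i.e. the supremum of the distances between its points.\<close>

definition interval_length :: "complex set \<Rightarrow> ereal" where
  "interval_length I = (SUP x\<in>I. SUP y\<in>I. ereal (hdist x y))"

lemma interval_length_geodesic:
  assumes "geodesic_line \<sigma>" "a < b" "{a<..<b} \<subseteq> I" "I \<subseteq> {a..b}"
  shows "interval_length (\<sigma> ` I) = ereal (b - a)"
proof (rule antisym)
  have d: "hdist (\<sigma> s) (\<sigma> t) = \<bar>s - t\<bar>" for s t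
    using assms(1) by (simp add: geodesic_line_def)
  show "interval_length (\<sigma> ` I) \<le> ereal (b - a)"
    unfolding interval_length_def
  proof (intro SUP_least)
    fix x y
    assume "x \<in> \<sigma> ` I" "y \<in> \<sigma> ` I"
    then obtain s t where "x = \<sigma> s" "y = \<sigma> t" "s \<in> {a..b}" "t \<in> {a..b}"
      using assms(4) by blast
    then show "ereal (hdist x y) \<le> ereal (b - a)"
      by (auto simp: d)
  qed
  show "ereal (b - a) \<le> interval_length (\<sigma> ` I)"
  proof (rule ereal_le_epsilon2)
    fix e :: real
    assume e: "e > 0"
    define h where "h = min (e / 2) ((b - a) / 4)"
    have h: "h > 0" "2 * h \<le> e" "4 * h \<le> b - a"
      using e assms(2) by (auto simp: h_def min_def field_simps)
    have "a + h \<in> I" "b - h \<in> I"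
      using h assms(3) by auto
    then have "ereal (hdist (\<sigma> (a + h)) (\<sigma> (b - h))) \<le> interval_length (\<sigma> ` I)"
      unfolding interval_length_def by (meson SUP_upper2 imageI order_refl)
    moreover have "hdist (\<sigma> (a + h)) (\<sigma> (b - h)) \<ge> b - a - e"
      using h by (simp add: d)
    ultimately have "ereal (b - a - e) \<le> interval_length (\<sigma> ` I)"
      using ereal_less_eq(3) order_trans by blast
    then show "ereal (b - a) \<le> interval_length (\<sigma> ` I) + ereal e"
      by (cases "interval_length (\<sigma> ` I)") auto
  qed
qed

end

theory Submission
  imports Defs
begin

text \<open>Orientability makes the covering translations elements of \<open>SL(2, \<real>)\<close>. Since \<open>\<Gamma>\<close> is
  countable, the lines \<open>l\<close> and \<open>m\<close> differ by some \<open>h \<in> \<Gamma>\<close>, and some \<open>g \<in> \<Gamma>\<close> translates \<open>l\<close> by \<open>L\<close>;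
  put \<open>l\<close> on the imaginary axis, so that \<open>g\<close> is diagonal. A discrete torsion-free group contains no
  element with trace in \<open>(-2, 2)\<close>. Suppose that the projection has length at least \<open>L\<close>. If the lines are
  traversed in roughly opposite directions, then \<open>h\<close>, corrected by a power of \<open>g\<close>, is close to a
  half-turn and has trace in \<open>(-2, 2)\<close>. If the directions agree and the lines are disjoint, then the
  commutator of \<open>g\<close> and \<open>h\<close> has trace in \<open>(1, 2)\<close>. If the directions agree and the lines cross, this trace
  is in \<open>(2, 3)\<close>, and reducing the pair \<open>(g, h)\<close> by Nielsen moves, which preserve the trace of
  the commutator, produces an elliptic element. If the directions agree and the lines share an
  end point, the commutator is parabolic and its conjugates by the powers of \<open>g\<close> accumulate at the identity.\<close>

section \<open>Discrete torsion-free subgroups of SL(2, R)\<close>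

type_synonym mat2 = "real \<times> real \<times> real \<times> real"

fun mmul :: "mat2 \<Rightarrow> mat2 \<Rightarrow> mat2" where
  "mmul (a, b, c, d) (a', b', c', d') =
     (a * a' + b * c', a * b' + b * d', c * a' + d * c', c * b' + d * d')"

text \<open>The adjugate stands in for the inverse, with which it agrees at determinant 1. Being
  linear in the entries, it is continuous and fits into polynomial trace identities.\<close>

fun madj :: "mat2 \<Rightarrow> mat2" where
  "madj (a, b, c, d) = (d, - b, - c, a)"

fun mdet :: "mat2 \<Rightarrow> real" where
  "mdet (a, b, c, d) = a * d - b * c"

fun mtr :: "mat2 \<Rightarrow> real" where
  "mtr (a, b, c, d) = a + d"

definition mone :: mat2 where
  "mone = (1, 0, 0, 1)"

fun mpow :: "mat2 \<Rightarrow> nat \<Rightarrow> mat2" where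
  "mpow A 0 = mone"
| "mpow A (Suc n) = mmul A (mpow A n)"

text \<open>\<open>mdiag s\<close> acts on the half-plane as multiplication by
  \<open>exp (2 * s)\<close>, so \<open>mdiag (L / 2)\<close> translates the imaginary axis by
  \<open>L\<close>.\<close>

definition mdiag :: "real \<Rightarrow> mat2" where
  "mdiag s = (exp s, 0, 0, exp (- s))"

lemma mmul_assoc: "mmul (mmul A B) C = mmul A (mmul B C)"
  by (cases A; cases B; cases C) (simp add: algebra_simps)

lemma mmul_mone [simp]: "mmul mone A = A" "mmul A mone = A"
  by (cases A; simp add: mone_def)+

lemma mmul_madj:
  assumes "mdet A = 1"
  shows "mmul A (madj A) = mone" "mmul (madj A) A = mone"
  using assms by (cases A; simp add: mone_def algebra_simps)+

lemma mmul_madj_cancel: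
  assumes "mdet A = 1"
  shows "mmul A (mmul (madj A) B) = B" "mmul (madj A) (mmul A B) = B"
  using mmul_madj[OF assms] by (simp_all flip: mmul_assoc)

lemma madj_mmul: "madj (mmul A B) = mmul (madj B) (madj A)"
  by (cases A; cases B) (simp add: algebra_simps)

lemma madj_madj [simp]: "madj (madj A) = A"
  by (cases A) simp

lemma mdet_mmul [simp]: "mdet (mmul A B) = mdet A * mdet B"
  by (cases A; cases B) (simp add: algebra_simps)

lemma mdet_madj [simp]: "mdet (madj A) = mdet A"
  by (cases A) (simp add: algebra_simps)

lemma mdet_mone [simp]: "mdet mone = 1"
  by (simp add: mone_def)

lemma mdet_mdiag [simp]: "mdet (mdiag s) = 1"
  by (simp add: mdiag_def flip: exp_add)

lemma mdet_uminus [simp]: "mdet (- A) = mdet A"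
  by (cases A) simp

lemma mdet_mpow: "mdet A = 1 \<Longrightarrow> mdet (mpow A n) = 1"
  by (induction n) auto

lemma mmul_uminus: "mmul (- A) B = - mmul A B" "mmul A (- B) = - mmul A B"
  by (cases A; cases B; simp)+

lemma mpow_add: "mpow A (m + n) = mmul (mpow A m) (mpow A n)"
  by (induction m) (auto simp: mmul_assoc)

lemma mpow_mdiag: "mpow (mdiag s) n = mdiag (n * s)"
  by (induction n) (auto simp: mdiag_def mone_def ring_distribs simp flip: exp_add)

lemma madj_mdiag: "madj (mdiag s) = mdiag (- s)"
  by (simp add: mdiag_def)

lemma mtr_uminus [simp]: "mtr (- A) = - mtr A"
  by (cases A) simp

lemma mtr_mmul_commute: "mtr (mmul A B) = mtr (mmul B A)"
  by (cases A; cases B) (simp add: algebra_simps)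

lemma mtr_mmul_madj: "mtr (mmul A (madj B)) = mtr A * mtr B - mtr (mmul A B)"
  by (cases A; cases B) (simp add: algebra_simps)

lemma mtr_mmul_mmul: "mtr (mmul B (mmul A B)) = mtr (mmul A B) * mtr B - mtr A * mdet B"
  by (cases A; cases B) (simp add: algebra_simps)

lemma mtr_mmul_mmul_madj: "mtr (mmul B (mmul A (madj B))) = mtr A * mdet B"
  by (cases A; cases B) (simp add: algebra_simps)

text \<open>Fricke's trace identity. It turns a bound on the commutator into a relation between
  three traces, on which a descent can work.\<close>

lemma mtr_commutator:
  assumes "mdet A = 1" "mdet B = 1"
  shows "mtr (mmul (mmul A B) (mmul (madj A) (madj B))) =
    (mtr A)\<^sup>2 + (mtr B)\<^sup>2 + (mtr (mmul A B))\<^sup>2 - mtr A * mtr B * mtr (mmul A B) - 2"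
proof -
  obtain a b c d where A: "A = (a, b, c, d)" by (cases A)
  obtain a' b' c' d' where B: "B = (a', b', c', d')" by (cases B)
  have "a * d - b * c = 1" "a' * d' - b' * c' = 1" using assms A B by auto
  then show ?thesis unfolding A B by simp algebra
qed

lemma tendsto_mmul [tendsto_intros]:
  assumes "(f \<longlongrightarrow> A) F" "(g \<longlongrightarrow> B) F"
  shows "((\<lambda>x. mmul (f x) (g x)) \<longlongrightarrow> mmul A B) F"
proof -
  have eq: "mmul A B =
    (fst A * fst B + fst (snd A) * fst (snd (snd B)),
     fst A * fst (snd B) + fst (snd A) * snd (snd (snd B)),
     fst (snd (snd A)) * fst B + snd (snd (snd A)) * fst (snd (snd B)),
     fst (snd (snd A)) * fst (snd B) + snd (snd (snd A)) * snd (snd (snd B)))" for A B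
    by (cases A; cases B) simp
  show ?thesis unfolding eq by (intro tendsto_intros assms)
qed

lemma tendsto_madj [tendsto_intros]:
  assumes "(f \<longlongrightarrow> A) F"
  shows "((\<lambda>x. madj (f x)) \<longlongrightarrow> madj A) F"
proof -
  have eq: "madj A =
    (snd (snd (snd A)), - fst (snd A), - fst (snd (snd A)), fst A)" for A
    by (cases A) simp
  show ?thesis unfolding eq by (intro tendsto_intros assms)
qed

lemma tendsto_mdet [tendsto_intros]:
  assumes "(f \<longlongrightarrow> A) F"
  shows "((\<lambda>x. mdet (f x)) \<longlongrightarrow> mdet A) F"
proof -
  have eq: "mdet A = fst A * snd (snd (snd A)) - fst (snd A) * fst (snd (snd A))" for A
    by (cases A) simp
  show ?thesis unfolding eq by (intro tendsto_intros assms)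
qed

section \<open>Discreteness and elliptic elements\<close>

lemma mpow_elliptic:
  assumes "mdet A = 1" "mtr A = 2 * cos \<phi>" "sin \<phi> \<noteq> 0"
  shows "mpow A n = (sin (n * \<phi>) / sin \<phi>) *\<^sub>R A - (sin (n * \<phi> - \<phi>) / sin \<phi>) *\<^sub>R mone"
proof (induction n)
  case 0
  then show ?case using assms(3) by (cases A) (simp add: mone_def)
next
  case (Suc n)
  obtain a b c d where A: "A = (a, b, c, d)" by (cases A)
  \<comment> \<open>Up to an index shift these are the Chebyshev polynomials of the second kind at
    \<open>cos \<phi>\<close>. The Cayley-Hamilton relation A A = (tr A) A - 1 produces their
    recurrence.\<close>
  define p q where "p = sin (n * \<phi>) / sin \<phi>" and "q = sin (n * \<phi> - \<phi>) / sin \<phi>"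
  have det: "a * d - b * c = 1" and tr: "a + d = 2 * cos \<phi>" using assms A by auto
  have "sin (Suc n * \<phi>) = sin (n * \<phi> + \<phi>)"
    by (simp add: algebra_simps)
  then have "sin (Suc n * \<phi>) = 2 * cos \<phi> * sin (n * \<phi>) - sin (n * \<phi> - \<phi>)"
    by (simp add: sin_add sin_diff)
  then have next_p: "sin (Suc n * \<phi>) / sin \<phi> = (a + d) * p - q"
    by (simp add: p_def q_def diff_divide_distrib tr)
  have next_q: "sin (Suc n * \<phi> - \<phi>) / sin \<phi> = p"
    by (simp add: p_def algebra_simps)
  have IH: "mpow A n = p *\<^sub>R A - q *\<^sub>R mone"
    using Suc by (simp add: p_def q_def)
  have "a * (p * a - q) + b * (p * c) = ((a + d) * p - q) * a - p"
    "a * (p * b) + b * (p * d - q) = ((a + d) * p - q) * b"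
    "c * (p * a - q) + d * (p * c) = ((a + d) * p - q) * c"
    "c * (p * b) + d * (p * d - q) = ((a + d) * p - q) * d - p"
    using det by algebra+
  then show ?case
    unfolding next_p next_q mpow.simps IH unfolding A mone_def by simp
qed

text \<open>\<open>G\<close> models the full preimage in SL(2, R) of a group of isometries, whence
  closure under \<open>-\<close> and torsion-freeness modulo sign. Isolation of \<open>mone\<close>
  spreads to all elements by translation, see \<open>discrete\<close>.\<close>

locale sl2_discrete =
  fixes G :: "mat2 set"
  assumes det: "A \<in> G \<Longrightarrow> mdet A = 1"
    and mul: "A \<in> G \<Longrightarrow> B \<in> G \<Longrightarrow> mmul A B \<in> G"
    and adj: "A \<in> G \<Longrightarrow> madj A \<in> G"
    and minus: "A \<in> G \<Longrightarrow> - A \<in> G"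
    and isolated: "mone isolated_in G"
    and torsion_free: "A \<in> G \<Longrightarrow> n > 0 \<Longrightarrow> mpow A n = mone \<Longrightarrow> A = mone \<or> A = - mone"
begin

lemma one: "mone \<in> G"
  using isolated by (auto simp: isolated_in_def)

lemma eventually_one:
  assumes "f \<longlonglongrightarrow> mone" "\<And>n::nat. f n \<in> G"
  shows "eventually (\<lambda>n. f n = mone) sequentially"
proof -
  obtain T where T: "open T" "T \<inter> G = {mone}"
    using isolated by (auto simp: isolated_in_def)
  then have "eventually (\<lambda>n. f n \<in> T) sequentially"
    by (intro topological_tendstoD[OF assms(1)]) auto
  then show ?thesis
    by (rule eventually_mono) (use T assms(2) in auto)
qed

lemma pow: "A \<in> G \<Longrightarrow> mpow A n \<in> G"
  by (induction n) (auto intro: mul one)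

text \<open>An element with trace in (-2, 2) has bounded powers by \<open>mpow_elliptic\<close>.
  Along a convergent subsequence the quotients of successive terms tend to \<open>mone\<close>, so
  by isolation some positive power equals \<open>mone\<close>, against
  \<open>torsion_free\<close>.\<close>

lemma abs_mtr_ge_2:
  assumes "A \<in> G"
  shows "\<bar>mtr A\<bar> \<ge> 2"
proof (rule ccontr)
  assume "\<not> \<bar>mtr A\<bar> \<ge> 2"
  then have tr: "\<bar>mtr A / 2\<bar> < 1" by simp
  define \<phi> where "\<phi> = arccos (mtr A / 2)"
  have cos: "mtr A = 2 * cos \<phi>"
    using tr by (simp add: \<phi>_def cos_arccos_abs)
  have sin: "sin \<phi> \<noteq> 0"
    using tr unfolding \<phi>_def by (intro sin_arccos_nonzero) auto
  define C where "C = norm A / \<bar>sin \<phi>\<bar> + norm mone / \<bar>sin \<phi>\<bar>"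
  have "norm (mpow A n) \<le> C" for n
  proof -
    have "norm (mpow A n) \<le> \<bar>sin (n * \<phi>)\<bar> / \<bar>sin \<phi>\<bar> * norm A
        + \<bar>sin (n * \<phi> - \<phi>)\<bar> / \<bar>sin \<phi>\<bar> * norm mone"
      unfolding mpow_elliptic[OF det[OF assms] cos sin]
      by (rule order_trans[OF norm_triangle_ineq4]) simp
    also have "\<dots> \<le> 1 / \<bar>sin \<phi>\<bar> * norm A + 1 / \<bar>sin \<phi>\<bar> * norm mone"
      by (intro add_mono mult_right_mono divide_right_mono) auto
    finally show ?thesis by (simp add: C_def)
  qed
  then have "bounded (range (mpow A))"
    by (auto simp: bounded_iff)
  then obtain X r where r: "strict_mono (r :: nat \<Rightarrow> nat)" and X: "(mpow A \<circ> r) \<longlonglongrightarrow> X"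
    using bounded_imp_convergent_subsequence by blast
  have X1: "(\<lambda>n. mpow A (r n)) \<longlonglongrightarrow> X"
    using X by (simp add: o_def)
  have "(\<lambda>n. mdet (mpow A (r n))) \<longlonglongrightarrow> mdet X"
    by (intro tendsto_intros X1)
  then have "mdet X = 1"
    using mdet_mpow[OF det[OF assms]] by (simp add: LIMSEQ_const_iff)
  have "(\<lambda>n. mmul (madj (mpow A (r n))) (mpow A (r (Suc n)))) \<longlonglongrightarrow> mmul (madj X) X"
    by (intro tendsto_intros X1 LIMSEQ_Suc)
  then have "(\<lambda>n. mmul (madj (mpow A (r n))) (mpow A (r (Suc n)))) \<longlonglongrightarrow> mone"
    using mmul_madj[OF \<open>mdet X = 1\<close>] by simp
  then have "eventually (\<lambda>n. mmul (madj (mpow A (r n))) (mpow A (r (Suc n))) = mone) sequentially"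
    by (rule eventually_one) (intro mul adj pow assms)
  then obtain n where n: "mmul (madj (mpow A (r n))) (mpow A (r (Suc n))) = mone"
    by (auto simp: eventually_sequentially)
  have lt: "r n < r (Suc n)" using r by (simp add: strict_mono_Suc_iff)
  have "mpow A (r (Suc n)) = mmul (mpow A (r n)) (mpow A (r (Suc n) - r n))"
    using lt by (simp flip: mpow_add)
  then have "mpow A (r (Suc n) - r n) = mone"
    using n by (simp add: mmul_madj_cancel mdet_mpow det assms)
  then have "A = mone \<or> A = - mone"
    using torsion_free[OF assms, of "r (Suc n) - r n"] lt by simp
  then show False
    using tr by (auto simp: mone_def)
qed

end

section \<open>Nielsen reduction of a pair of matrices\<close>

lemma trace_descent_step:
  fixes x y z w \<delta> M :: real
  assumes "2 \<le> y" "y \<le> x" "x \<le> M" "w \<le> z" "z + w = x * y"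
    and zw: "z * w = x\<^sup>2 + y\<^sup>2 - 4 - \<delta>" and \<delta>: "0 < \<delta>" "\<delta> < 4"
  shows "0 < w" "w \<le> x - \<delta> / M\<^sup>2"
proof -
  have "x\<^sup>2 \<ge> 4" "y\<^sup>2 \<ge> 4"
    using assms power_mono[of 2 x 2] power_mono[of 2 y 2] by auto
  then have "z * w > 0" using zw \<delta> by simp
  moreover have "z > 0"
    using assms by (smt (verit) mult_pos_pos)
  ultimately show "0 < w" by (simp add: zero_less_mult_iff)
  \<comment> \<open>Since \<open>z + w = x * y\<close>, this is \<open>z - x\<close>. The identity
    below makes (x - w)(z - x) at least \<open>\<delta>\<close>, so \<open>x\<close> separates
    \<open>w\<close> from \<open>z\<close>; the bound on \<open>T\<close> turns this into a definite
    gap between \<open>w\<close> and \<open>x\<close>.\<close>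
  define T where "T = x * y - x - w"
  have id: "(x - w) * T = (y - 2) * (x\<^sup>2 - y - 2) + \<delta>"
  proof -
    have "w * (x * y - w) = x\<^sup>2 + y\<^sup>2 - 4 - \<delta>"
      using zw assms(5) by (metis add_diff_cancel_right' mult.commute)
    then show ?thesis unfolding T_def by algebra
  qed
  have "2 * x \<le> x\<^sup>2"
    using assms by (simp add: power2_eq_square)
  then have "x\<^sup>2 - y - 2 \<ge> 0"
    using assms by linarith
  then have le: "\<delta> \<le> (x - w) * T"
    using id assms(1) by simp
  have "2 * w \<le> x * y" using assms by linarith
  moreover have "x * y \<ge> 2 * x" using assms by simp
  ultimately have "T \<ge> 0" unfolding T_def by linarith
  have "x * y \<le> M * M"
    using assms by (intro mult_mono) auto
  then have "T \<le> M\<^sup>2"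
    unfolding T_def power2_eq_square using \<open>0 < w\<close> assms by linarith
  have "x - w > 0"
    using le \<delta>(1) \<open>T \<ge> 0\<close> by (smt (verit) mult_nonpos_nonneg)
  then have "\<delta> \<le> (x - w) * M\<^sup>2"
    using le \<open>T \<le> M\<^sup>2\<close> by (smt (verit) mult_left_mono)
  moreover have "M\<^sup>2 > 0" using assms by auto
  ultimately show "w \<le> x - \<delta> / M\<^sup>2"
    by (simp add: field_simps)
qed

context sl2_discrete
begin

text \<open>The right-hand side of \<open>mtr_commutator\<close>. In this polynomial form,
  invariance under sign changes and Nielsen moves is a matter of algebra.\<close>

definition commutator_trace :: "mat2 \<Rightarrow> mat2 \<Rightarrow> real" where
  "commutator_trace A B =
     (mtr A)\<^sup>2 + (mtr B)\<^sup>2 + (mtr (mmul A B))\<^sup>2 - mtr A * mtr B * mtr (mmul A B) - 2"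

text \<open>Replacing the element of larger trace by \<open>A B\<close> or \<open>A B\<^sup>-\<^sup>1\<close> lowers the sum of the traces by at least
  the fixed amount \<open>\<delta> / M\<^sup>2\<close>, which cannot go on with all traces at least 2.\<close>

lemma trace_descent:
  fixes n :: nat
  assumes "A \<in> G" "B \<in> G" "2 \<le> mtr A" "2 \<le> mtr B" "mtr A \<le> M" "mtr B \<le> M"
    and "commutator_trace A B = \<delta> + 2" "0 < \<delta>" "\<delta> < 4"
    and "mtr A + mtr B < 4 + n * (\<delta> / M\<^sup>2)"
  shows False
  using assms
proof (induction n arbitrary: A B)
  case 0
  then show ?case by simp
next
  case (Suc n)
  \<comment> \<open>The element of larger trace is the one to be replaced; the case distinction at
    the end exchanges the roles.\<close>
  have step: False
    if AB: "A \<in> G" "B \<in> G" "2 \<le> mtr B" "mtr B \<le> mtr A" "mtr A \<le> M"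
      and tr: "commutator_trace A B = \<delta> + 2"
      and sum: "mtr A + mtr B < 4 + Suc n * (\<delta> / M\<^sup>2)" for A B
  proof -
    define x y z w where "x = mtr A" and "y = mtr B"
      and "z = mtr (mmul A B)" and "w = mtr (mmul A (madj B))"
    have zw: "z + w = x * y" by (simp add: x_def y_def z_def w_def mtr_mmul_madj)
    then have w: "w = x * y - z" by simp
    have "x\<^sup>2 + y\<^sup>2 + z\<^sup>2 - x * y * z = \<delta> + 4"
      using tr by (simp add: commutator_trace_def x_def y_def z_def)
    then have prod: "z * w = x\<^sup>2 + y\<^sup>2 - 4 - \<delta>"
      unfolding w by algebra
    \<comment> \<open>The new pair has the trace triple (y, z, y z - x). This is a Vieta move, which
      preserves x^2 + y^2 + z^2 - x y z; likewise for \<open>ctr2\<close>.\<close>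
    have ctr1: "commutator_trace B (mmul A B) = \<delta> + 2"
    proof -
      have "mtr (mmul B (mmul A B)) = z * y - x"
        using mtr_mmul_mmul[of B A] det[OF AB(2)] by (simp add: x_def y_def z_def)
      then show ?thesis
        using tr unfolding commutator_trace_def x_def[symmetric] y_def[symmetric] z_def[symmetric]
        by algebra
    qed
    have ctr2: "commutator_trace B (mmul A (madj B)) = \<delta> + 2"
    proof -
      have "mtr (mmul B (mmul A (madj B))) = x"
        using mtr_mmul_mmul_madj[of B A] det[OF AB(2)] by (simp add: x_def)
      then have "commutator_trace B (mmul A (madj B)) = y\<^sup>2 + w\<^sup>2 + x\<^sup>2 - y * w * x - 2"
        by (simp add: commutator_trace_def y_def w_def)
      also have "\<dots> = x\<^sup>2 + y\<^sup>2 + z\<^sup>2 - x * y * z - 2"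
        unfolding w by algebra
      finally show ?thesis
        using tr by (simp add: commutator_trace_def x_def y_def z_def)
    qed
    have "\<delta> / M\<^sup>2 \<ge> 0" using Suc.prems by simp
    have sum_n: "x + y < 4 + n * (\<delta> / M\<^sup>2) + \<delta> / M\<^sup>2"
      using sum by (simp add: x_def y_def ring_distribs add_divide_distrib)
    show False
    proof (cases "w \<le> z")
      case True
      have *: "0 < w" "w \<le> x - \<delta> / M\<^sup>2"
        using trace_descent_step[of y x M w z \<delta>] True zw prod Suc.prems AB
        by (auto simp: x_def y_def)
      have "mmul A (madj B) \<in> G" using AB by (intro mul adj)
      \<comment> \<open>Positivity excludes traces of at most -2, so the new pair satisfies the sign
        conditions of the induction hypothesis.\<close>
      then have "2 \<le> w" using abs_mtr_ge_2 *(1) unfolding w_def by fastforce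
      moreover have "w \<le> M"
        using *(2) \<open>\<delta> / M\<^sup>2 \<ge> 0\<close> AB by (simp add: x_def)
      moreover have "y + w < 4 + n * (\<delta> / M\<^sup>2)"
        using *(2) sum_n by linarith
      ultimately show False
        using Suc.IH[of B "mmul A (madj B)"] ctr2 AB \<open>mmul A (madj B) \<in> G\<close> Suc.prems
        unfolding y_def w_def by simp
    next
      case False
      have *: "0 < z" "z \<le> x - \<delta> / M\<^sup>2"
        using trace_descent_step[of y x M z w \<delta>] False zw prod Suc.prems AB
        by (auto simp: x_def y_def algebra_simps)
      have "mmul A B \<in> G" using AB by (intro mul)
      then have "2 \<le> z" using abs_mtr_ge_2 *(1) unfolding z_def by fastforce
      moreover have "z \<le> M"
        using *(2) \<open>\<delta> / M\<^sup>2 \<ge> 0\<close> AB by (simp add: x_def)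
      moreover have "y + z < 4 + n * (\<delta> / M\<^sup>2)"
        using *(2) sum_n by linarith
      ultimately show False
        using Suc.IH[of B "mmul A B"] ctr1 AB \<open>mmul A B \<in> G\<close> Suc.prems
        unfolding y_def z_def by simp
    qed
  qed
  show ?case
  proof (cases "mtr B \<le> mtr A")
    case True
    then show ?thesis using step[of A B] Suc.prems by simp
  next
    case False
    have "commutator_trace B A = \<delta> + 2"
      using Suc.prems(7) by (simp add: commutator_trace_def mtr_mmul_commute[of B A] algebra_simps)
    then show ?thesis using step[of B A] Suc.prems False by (simp add: add.commute)
  qed
qed

text \<open>Changing signs makes both traces at least 2 and leaves the commutator trace alone. Then
  \<open>n\<close> is chosen so large that \<open>n\<close> steps of \<open>trace_descent\<close>
  would push the sum of the traces below 4.\<close>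

lemma commutator_trace_gap:
  assumes "A \<in> G" "B \<in> G" "2 < commutator_trace A B" "commutator_trace A B < 6"
  shows False
proof -
  define A' where "A' = (if mtr A < 0 then - A else A)"
  define B' where "B' = (if mtr B < 0 then - B else B)"
  have in_G: "A' \<in> G" "B' \<in> G" using assms minus by (auto simp: A'_def B'_def)
  have ge: "mtr A' \<ge> 2" "mtr B' \<ge> 2"
    using abs_mtr_ge_2[OF assms(1)] abs_mtr_ge_2[OF assms(2)] by (auto simp: A'_def B'_def)
  have tr: "commutator_trace A' B' = commutator_trace A B"
    by (simp add: commutator_trace_def A'_def B'_def mmul_uminus)
  define M where "M = max (mtr A') (mtr B')"
  define \<delta> where "\<delta> = commutator_trace A B - 2"
  have "\<delta> / M\<^sup>2 > 0"
    using assms ge unfolding \<delta>_def M_def by (intro divide_pos_pos) auto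
  then obtain n where "mtr A' + mtr B' - 4 < real n * (\<delta> / M\<^sup>2)"
    using reals_Archimedean3 by blast
  then show False
    using trace_descent[of A' B' M \<delta> n] in_G ge tr assms
    by (auto simp: M_def \<delta>_def)
qed

end

context sl2_discrete
begin

lemma commutator_trace_eq:
  assumes "A \<in> G" "B \<in> G"
  shows "commutator_trace A B = mtr (mmul (mmul A B) (mmul (madj A) (madj B)))"
  using assms by (simp add: commutator_trace_def mtr_commutator det)

lemma abs_commutator_trace_ge_2:
  assumes "A \<in> G" "B \<in> G"
  shows "\<bar>commutator_trace A B\<bar> \<ge> 2"
  unfolding commutator_trace_eq[OF assms] by (intro abs_mtr_ge_2 mul adj assms)

end

section \<open>Groups containing a translation by \<open>L\<close> along the imaginary axis\<close>

locale sl2_discrete_hyperbolic = sl2_discrete +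
  fixes L :: real
  assumes L_pos: "L > 0" and diag: "mdiag (L / 2) \<in> G"
begin

lemma mdiag_int: "mdiag (of_int k * L / 2) \<in> G"
proof (cases "k \<ge> 0")
  case True
  then show ?thesis
    using pow[OF diag, of "nat k"] by (simp add: mpow_mdiag)
next
  case False
  then show ?thesis
    using adj[OF pow[OF diag, of "nat (- k)"]] by (simp add: mpow_mdiag madj_mdiag)
qed

lemma exp_decay: "(\<lambda>n. exp (- (real n * L)) * x) \<longlonglongrightarrow> 0"
proof -
  have "(\<lambda>n. exp (- L) ^ n) \<longlonglongrightarrow> 0"
    using L_pos by (intro LIMSEQ_realpow_zero) auto
  then have "(\<lambda>n. exp (- (real n * L))) \<longlonglongrightarrow> 0"
    by (simp flip: exp_of_nat_mult)
  then show ?thesis by (rule tendsto_mult_left_zero)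
qed

text \<open>Conjugation by powers of the diagonal element shrinks the off-diagonal entry
  geometrically, so a nonzero \<open>x\<close> would give elements of \<open>G\<close> accumulating
  at \<open>mone\<close>. For \<open>upper_unipotent\<close> the inverse powers do the same.\<close>

lemma lower_unipotent:
  assumes "(1, 0, x, 1) \<in> G"
  shows "x = 0"
proof -
  define f where "f n = mmul (mdiag (of_int (int n) * L / 2))
    (mmul (1, 0, x, 1) (mdiag (of_int (- int n) * L / 2)))" for n
  have f: "f n = (1, 0, exp (- (real n * L)) * x, 1)" for n
    by (simp add: f_def mdiag_def field_simps flip: exp_add)
  have "f \<longlonglongrightarrow> mone"
    unfolding f mone_def by (intro tendsto_Pair tendsto_const exp_decay)
  then have "eventually (\<lambda>n. f n = mone) sequentially"
    by (rule eventually_one) (unfold f_def, intro mul mdiag_int assms)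
  then show ?thesis
    by (auto simp: f mone_def eventually_sequentially)
qed

lemma upper_unipotent:
  assumes "(1, x, 0, 1) \<in> G"
  shows "x = 0"
proof -
  define f where "f n = mmul (mdiag (of_int (- int n) * L / 2))
    (mmul (1, x, 0, 1) (mdiag (of_int (int n) * L / 2)))" for n
  have f: "f n = (1, exp (- (real n * L)) * x, 0, 1)" for n
    by (simp add: f_def mdiag_def field_simps flip: exp_add)
  have "f \<longlonglongrightarrow> mone"
    unfolding f mone_def by (intro tendsto_Pair tendsto_const exp_decay)
  then have "eventually (\<lambda>n. f n = mone) sequentially"
    by (rule eventually_one) (unfold f_def, intro mul mdiag_int assms)
  then show ?thesis
    by (auto simp: f mone_def eventually_sequentially)
qed

text \<open>At determinant 1 the trace of this matrix depends only on \<open>b * c\<close>, and for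
  \<open>b * c = 0\<close> both diagonal entries are 1.\<close>

lemma mdiag_commutator:
  "mmul (mmul (mdiag (L / 2)) (a, b, c, d)) (mmul (madj (mdiag (L / 2))) (madj (a, b, c, d))) =
   (a * d - exp L * (b * c), a * b * (exp L - 1), c * d * (exp (- L) - 1), a * d - exp (- L) * (b * c))"
proof -
  have gen: "p * a * (r * d) - p * b * (p * c) = a * d - P * (b * c)"
    "p * b * (p * a) - p * a * (r * b) = a * b * (P - 1)"
    "r * c * (r * d) - r * d * (p * c) = c * d * (R - 1)"
    "r * d * (p * a) - r * c * (r * b) = a * d - R * (b * c)"
    if eqs: "p * p = P" "r * r = R" "p * r = 1" for p r P R :: real
  proof -
    have "p * a * (r * d) - p * b * (p * c) = p * r * (a * d) - p * p * (b * c)"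
      "p * b * (p * a) - p * a * (r * b) = a * b * (p * p - p * r)"
      "r * c * (r * d) - r * d * (p * c) = c * d * (r * r - p * r)"
      "r * d * (p * a) - r * c * (r * b) = p * r * (a * d) - r * r * (b * c)"
      by (simp_all add: algebra_simps)
    then show "p * a * (r * d) - p * b * (p * c) = a * d - P * (b * c)"
      "p * b * (p * a) - p * a * (r * b) = a * b * (P - 1)"
      "r * c * (r * d) - r * d * (p * c) = c * d * (R - 1)"
      "r * d * (p * a) - r * c * (r * b) = a * d - R * (b * c)"
      by (simp_all add: eqs)
  qed
  show ?thesis
    using gen[of "exp (L / 2)" "exp L" "exp (- (L / 2))" "exp (- L)"]
    by (simp add: mdiag_def flip: exp_add)
qed

text \<open>Here the matrix fixes 0 or infinity, an end of the imaginary axis. Its commutator with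
  the translation is unipotent, hence trivial, which kills the other off-diagonal entry.\<close>

lemma triangular_imp_diagonal:
  assumes W: "(a, b, c, d) \<in> G" and "b * c = 0"
  shows "b = 0 \<and> c = 0"
proof -
  have ad: "a * d = 1"
    using det[OF W] assms(2) by simp
  then have nz: "a \<noteq> 0" "d \<noteq> 0" by auto
  have C: "(1, a * b * (exp L - 1), c * d * (exp (- L) - 1), 1) \<in> G"
    using mul[OF mul[OF diag W] mul[OF adj[OF diag] adj[OF W]]]
    unfolding mdiag_commutator by (simp add: ad assms(2))
  show ?thesis
  proof (cases "b = 0")
    case True
    then have "c * d * (exp (- L) - 1) = 0"
      using C by (intro lower_unipotent) simp
    then show ?thesis using nz L_pos True by simp
  next
    case False
    then have "a * b * (exp L - 1) = 0"
      using C assms(2) by (intro upper_unipotent) simp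
    then show ?thesis using nz L_pos False by simp
  qed
qed

lemma mtr_mdiag_ge:
  assumes W: "(a, b, c, d) \<in> G"
  shows "2 \<le> \<bar>a * exp (of_int k * L / 2) + d * exp (- (of_int k * L / 2))\<bar>"
proof -
  have "mmul (a, b, c, d) (mdiag (of_int k * L / 2)) \<in> G"
    by (intro mul W mdiag_int)
  from abs_mtr_ge_2[OF this] show ?thesis
    by (simp add: mdiag_def)
qed

text \<open>A vanishing diagonal entry means that one end of the imaginary axis is carried to the
  opposite end. The trace of the product with a power of the translation is then a single term, and
  a suitable power brings it below 2.\<close>

lemma diagonal_nonzero:
  assumes W: "(a, b, c, d) \<in> G"
  shows "a * d \<noteq> 0"
proof
  assume zero: "a * d = 0"
  define x where "x = max \<bar>a\<bar> \<bar>d\<bar>"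
  have "2 \<le> (exp (- (real n * L)) * x)" for n
  proof (cases "a = 0")
    case True
    have "2 \<le> \<bar>d\<bar> * exp (- (real n * L))"
      using mtr_mdiag_ge[OF W, of "2 * int n"] True by (simp add: abs_mult)
    then show ?thesis using True by (simp add: x_def mult.commute)
  next
    case False
    then have "d = 0" using zero by simp
    then have "2 \<le> \<bar>a\<bar> * exp (- (real n * L))"
      using mtr_mdiag_ge[OF W, of "- 2 * int n"] by (simp add: abs_mult)
    then show ?thesis using \<open>d = 0\<close> by (simp add: x_def mult.commute)
  qed
  moreover have "eventually (\<lambda>n. exp (- (real n * L)) * x < 2) sequentially"
    by (rule order_tendstoD(2)[OF exp_decay]) simp
  ultimately show False
    by (simp add: eventually_sequentially not_less[symmetric])
qed

text \<open>Multiplying by a power of the diagonal element, the quotient of the diagonal entries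
  may be assumed to lie between \<open>exp (- L / 2)\<close> and \<open>exp (L / 2)\<close>, which minimizes the trace.\<close>

lemma balanced_trace_ge:
  assumes W: "(a, b, c, d) \<in> G"
  shows "2 \<le> \<bar>a * d\<bar> * cosh (L / 2) + a * d"
proof -
  have nz: "a \<noteq> 0" "d \<noteq> 0" using diagonal_nonzero[OF W] by auto
  define r where "r = ln (\<bar>a\<bar> / \<bar>d\<bar>)"
  \<comment> \<open>\<open>exp u\<close> is the quotient of the absolute values of the diagonal
    entries after multiplication by \<open>mdiag s\<close>; rounding brings \<open>u\<close> within
    \<open>L / 2\<close> of 0.\<close>
  define k where "k = - round (r / L)"
  define u where "u = r + of_int k * L"
  define s where "s = of_int k * L / 2"
  have "\<bar>of_int (round (r / L)) - r / L\<bar> \<le> 1 / 2"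
    by (rule of_int_round_abs_le)
  then have "\<bar>of_int (round (r / L)) - r / L\<bar> * L \<le> 1 / 2 * L"
    using L_pos by (intro mult_right_mono) auto
  moreover have "\<bar>of_int (round (r / L)) - r / L\<bar> * L = \<bar>u\<bar>"
    using L_pos by (simp add: u_def k_def abs_if field_simps)
  ultimately have "\<bar>u\<bar> \<le> L / 2" by simp
  then have cosh: "cosh u \<le> cosh (L / 2)"
    using cosh_real_nonneg_le_iff[of "\<bar>u\<bar>" "L / 2"] L_pos by simp
  have "exp r = \<bar>a\<bar> / \<bar>d\<bar>" using nz by (simp add: r_def)
  moreover have "exp s * exp s = exp u / exp r" "exp (- s) * exp (- s) = exp (- u) * exp r"
    by (simp_all add: s_def u_def flip: exp_add exp_diff)
  ultimately have exps: "exp s * exp s = exp u * (\<bar>d\<bar> / \<bar>a\<bar>)"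
    "exp (- s) * exp (- s) = exp (- u) * (\<bar>a\<bar> / \<bar>d\<bar>)"
    "exp s * exp (- s) = 1"
    by (simp_all flip: exp_add)
  have "4 \<le> (a * exp s + d * exp (- s))\<^sup>2"
    using mtr_mdiag_ge[OF W, of k] abs_le_square_iff[of 2 "a * exp s + d * exp (- s)"]
    by (simp add: s_def)
  also have "\<dots> = (a * a) * (exp s * exp s) + (d * d) * (exp (- s) * exp (- s))
      + 2 * (a * d) * (exp s * exp (- s))"
    by (simp add: power2_eq_square algebra_simps)
  also have "\<dots> = \<bar>a * d\<bar> * (exp u + exp (- u)) + 2 * (a * d)"
  proof -
    have *: "(a * a) * (x * (\<bar>d\<bar> / \<bar>a\<bar>)) = \<bar>a * d\<bar> * x"
      "(d * d) * (x * (\<bar>a\<bar> / \<bar>d\<bar>)) = \<bar>a * d\<bar> * x" for x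
      unfolding abs_mult using nz by (simp_all add: abs_if)
    show ?thesis unfolding exps * by (simp add: algebra_simps)
  qed
  also have "\<dots> = 2 * (\<bar>a * d\<bar> * cosh u + a * d)"
    by (simp add: cosh_field_def)
  also have "\<dots> \<le> 2 * (\<bar>a * d\<bar> * cosh (L / 2) + a * d)"
    using mult_left_mono[OF cosh, of "\<bar>a * d\<bar>"] by simp
  finally show ?thesis by simp
qed

text \<open>For \<open>W = (a, b, c, d)\<close>, the product \<open>\<xi> = b * c\<close> is an invariant of the pair consisting of the
  vertical line \<open>v\<close> and \<open>W v\<close>: these oriented lines cross at the angle with cosine \<open>1 + 2 * \<xi>\<close> if
  \<open>-1 < \<xi> < 0\<close>, and otherwise \<open>\<bar>1 + 2 * \<xi>\<bar>\<close> is the hyperbolic cosine of their distance. The left-hand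
  side is the length of the projection of one to the other.\<close>

lemma cross_ratio_bound:
  assumes W: "(a, b, c, d) \<in> G" and nz: "b * c \<noteq> 0"
  shows "\<bar>ln \<bar>a * d / (b * c)\<bar>\<bar> < L"
proof (rule ccontr)
  assume contra: "\<not> \<bar>ln \<bar>a * d / (b * c)\<bar>\<bar> < L"
  define \<xi> where "\<xi> = b * c"
  define E where "E = exp L"
  define q where "q = exp (L / 2)"
  have ad: "a * d = 1 + \<xi>" using det[OF W] by (simp add: \<xi>_def)
  have \<xi>: "\<xi> \<noteq> 0" "1 + \<xi> \<noteq> 0"
    using nz diagonal_nonzero[OF W] ad by (auto simp: \<xi>_def)
  have E: "E > 1" "q > 1" and E_eq: "E = q * q"
    using L_pos by (auto simp: E_def q_def simp flip: exp_add)
  have "L \<le> ln (\<bar>1 + \<xi>\<bar> / \<bar>\<xi>\<bar>) \<or> L \<le> - ln (\<bar>1 + \<xi>\<bar> / \<bar>\<xi>\<bar>)"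
    using contra unfolding ad \<xi>_def[symmetric] by (auto simp: abs_divide)
  moreover have "- ln (\<bar>1 + \<xi>\<bar> / \<bar>\<xi>\<bar>) = ln (\<bar>\<xi>\<bar> / \<bar>1 + \<xi>\<bar>)"
    using \<xi> by (simp add: ln_div)
  ultimately have "E \<le> \<bar>1 + \<xi>\<bar> / \<bar>\<xi>\<bar> \<or> E \<le> \<bar>\<xi>\<bar> / \<bar>1 + \<xi>\<bar>"
    using \<xi> by (simp add: E_def ln_ge_iff)
  \<comment> \<open>As \<open>E > 1\<close>, the two cases fix the sign of
    \<open>1 + 2 * \<xi>\<close>, that is, whether the directions of the lines roughly
    agree.\<close>
  then consider (parallel) "E * \<bar>\<xi>\<bar> \<le> \<bar>1 + \<xi>\<bar>" | (antiparallel) "E * \<bar>1 + \<xi>\<bar> \<le> \<bar>\<xi>\<bar>"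
    using \<xi> by (auto simp: field_simps)
  then show False
  proof cases
    case parallel
    have tr: "commutator_trace (mdiag (L / 2)) (a, b, c, d) = 2 - \<xi> * ((E - 1)\<^sup>2 / E)"
    proof -
      have "commutator_trace (mdiag (L / 2)) (a, b, c, d) = 2 * (1 + \<xi>) - (E + 1 / E) * \<xi>"
        unfolding commutator_trace_eq[OF diag W] mdiag_commutator mtr.simps ad
          \<xi>_def[symmetric] by (simp add: E_def exp_minus field_simps)
      also have "\<dots> = 2 - \<xi> * ((E - 1)\<^sup>2 / E)"
        using E by (simp add: field_simps power2_eq_square)
      finally show ?thesis .
    qed
    \<comment> \<open>For disjoint lines (\<open>\<xi> > 0\<close>) the commutator trace falls into
      (1, 2). For crossing lines it falls into (2, 3), where only
      \<open>commutator_trace_gap\<close> gives a contradiction.\<close>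
    consider "\<xi> > 0" | "\<xi> < 0" "- \<xi> < 1"
      using parallel E \<xi> by (smt (verit) mult_less_cancel_right1)
    then show False
    proof cases
      case 1
      then have "\<xi> * (E - 1) \<le> 1"
        using parallel by (simp add: algebra_simps)
      then have "\<xi> * (E - 1) * (E - 1) \<le> 1 * (E - 1)"
        using E by (intro mult_right_mono) auto
      then have "\<xi> * ((E - 1)\<^sup>2 / E) < 1"
        using E by (simp add: power2_eq_square field_simps)
      moreover have "\<xi> * ((E - 1)\<^sup>2 / E) > 0"
        using 1 E by (intro mult_pos_pos divide_pos_pos) auto
      ultimately show False
        using abs_commutator_trace_ge_2[OF diag W] tr by simp
    next
      case 2
      define \<eta> where "\<eta> = - \<xi>"
      have \<eta>: "\<eta> > 0" "\<eta> * (1 + E) \<le> 1"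
        using 2 parallel by (auto simp: \<eta>_def algebra_simps)
      have "\<eta> * (E - 1) \<le> \<eta> * (1 + E)"
        using \<eta> by simp
      then have "\<eta> * (E - 1) \<le> 1"
        using \<eta> by linarith
      then have "\<eta> * (E - 1) * (E - 1) \<le> 1 * (E - 1)"
        using E \<eta> by (intro mult_right_mono) auto
      then have "\<eta> * ((E - 1)\<^sup>2 / E) < 1"
        using E by (simp add: power2_eq_square field_simps)
      moreover have "\<eta> * ((E - 1)\<^sup>2 / E) > 0"
        using \<eta> E by (intro mult_pos_pos divide_pos_pos) auto
      ultimately show False
        using commutator_trace_gap[OF diag W] tr by (simp add: \<eta>_def)
    qed
  next
    case antiparallel
    define u where "u = 1 + \<xi>"
    have u: "u \<noteq> 0" "E * \<bar>u\<bar> \<le> \<bar>u - 1\<bar>" using \<xi> antiparallel by (auto simp: u_def)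
    have cosh: "cosh (L / 2) = (q + 1 / q) / 2"
      by (simp add: cosh_field_def q_def exp_minus field_simps)
    have ge: "2 \<le> \<bar>u\<bar> * ((q + 1 / q) / 2) + u"
      using balanced_trace_ge[OF W] by (simp add: ad u_def cosh)
    \<comment> \<open>Crossing lines: 4 q <= u (q + 1)^2 <= 2 u (1 + q^2) <= 2. Disjoint lines, with
      v = -u: 4 q <= v (q - 1)^2 <= v (q^2 - 1) <= 1. Both contradict \<open>q > 1\<close>.\<close>
    consider "u > 0" "u < 1" | "u < 0"
      using u E by (smt (verit) mult_less_cancel_right1)
    then show False
    proof cases
      case 1
      then have "u * (1 + q * q) \<le> 1"
        using u by (simp add: algebra_simps E_eq)
      moreover have "4 * q \<le> u * (q + 1)\<^sup>2"
        using ge 1 E by (simp add: field_simps power2_eq_square)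
      moreover have "u * (q + 1)\<^sup>2 \<le> u * (2 * (1 + q * q))"
        using 1 sum_squares_ge_zero[of "q - 1" 0]
        by (intro mult_left_mono) (auto simp: power2_eq_square algebra_simps)
      ultimately show False using E by linarith
    next
      case 2
      define v where "v = - u"
      have v: "v > 0" "v * (q * q - 1) \<le> 1"
        using 2 u by (auto simp: v_def algebra_simps E_eq)
      moreover have "4 * q \<le> v * (q - 1)\<^sup>2"
        using ge 2 E by (simp add: v_def field_simps power2_eq_square)
      moreover have "v * (q - 1)\<^sup>2 \<le> v * (q * q - 1)"
        using v E by (intro mult_left_mono) (auto simp: power2_eq_square algebra_simps)
      ultimately show False using E by linarith
    qed
  qed
qed

end

section \<open>Isometries and geodesics of the upper half-plane\<close>

fun mob :: "mat2 \<Rightarrow> complex \<Rightarrow> complex" where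
  "mob (a, b, c, d) z = (of_real a * z + of_real b) / (of_real c * z + of_real d)"

lemma mob_denominator:
  assumes "a * d - b * c = (1 :: real)" "z \<in> hplane"
  shows "of_real c * z + of_real d \<noteq> 0"
proof
  assume *: "of_real c * z + of_real d = 0"
  then have "Im (of_real c * z + of_real d) = 0" by simp
  then have "c = 0" using assms(2) by (simp add: hplane_def)
  then show False using * assms(1) by simp
qed

lemma Im_mob:
  assumes "a * d - b * c = 1" "z \<in> hplane"
  shows "Im (mob (a, b, c, d) z) = Im z / (cmod (of_real c * z + of_real d))\<^sup>2"
proof -
  have "a * Im z * (c * Re z + d) - (a * Re z + b) * (c * Im z) = Im z * (a * d - b * c)"
    by (simp add: algebra_simps)
  then show ?thesis
    using assms(1) by (simp add: Im_divide cmod_power2)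
qed

lemma mob_in_hplane [intro]:
  assumes "mdet A = 1" "z \<in> hplane"
  shows "mob A z \<in> hplane"
proof -
  obtain a b c d where A: "A = (a, b, c, d)" by (cases A)
  have det: "a * d - b * c = 1" using assms(1) A by simp
  show ?thesis
    using assms(2) mob_denominator[OF det assms(2)] Im_mob[OF det assms(2)] unfolding A hplane_def
    by (simp del: mob.simps)
qed

lemma mob_mone [simp]: "mob mone z = z"
  by (simp add: mone_def)

lemma mob_uminus [simp]: "mob (- A) z = mob A z"
proof -
  obtain a b c d where A: "A = (a, b, c, d)" by (cases A)
  have "mob (- A) z = (- (of_real a * z + of_real b)) / (- (of_real c * z + of_real d))"
    by (simp add: A)
  then show ?thesis
    by (simp add: A del: minus_add_distrib)
qed

lemma mob_mmul:
  assumes "mdet A = 1" "mdet B = 1" "z \<in> hplane"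
  shows "mob (mmul A B) z = mob A (mob B z)"
proof -
  obtain a b c d where A: "A = (a, b, c, d)" by (cases A)
  obtain a' b' c' d' where B: "B = (a', b', c', d')" by (cases B)
  define p q where "p = of_real a' * z + of_real b'" and "q = of_real c' * z + of_real d'"
  have q: "q \<noteq> 0"
    using assms mob_denominator[of a' d' b' c'] B by (simp add: q_def)
  have "mob A (mob B z) = ((of_real a * p + of_real b * q) / q) / ((of_real c * p + of_real d * q) / q)"
    unfolding A B mob.simps p_def[symmetric] q_def[symmetric] using q
    by (simp add: add_divide_distrib)
  also have "\<dots> = (of_real a * p + of_real b * q) / (of_real c * p + of_real d * q)"
    using q by simp
  also have "\<dots> = mob (mmul A B) z"
    unfolding A B p_def q_def by (simp add: algebra_simps)
  finally show ?thesis by simp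
qed

lemma mob_madj_cancel:
  assumes "mdet A = 1" "z \<in> hplane"
  shows "mob A (mob (madj A) z) = z" "mob (madj A) (mob A z) = z"
  using assms mmul_madj[OF assms(1)] by (simp_all flip: mob_mmul)

lemma mob_diff:
  assumes "a * d - b * c = 1" "z \<in> hplane" "w \<in> hplane"
  shows "mob (a, b, c, d) z - mob (a, b, c, d) w =
    (z - w) / ((of_real c * z + of_real d) * (of_real c * w + of_real d))"
proof -
  have "(of_real a * z + of_real b) * (of_real c * w + of_real d)
      - (of_real a * w + of_real b) * (of_real c * z + of_real d) = of_real (a * d - b * c) * (z - w)"
    by (simp add: algebra_simps)
  then show ?thesis
    using mob_denominator[OF assms(1,2)] mob_denominator[OF assms(1,3)] assms(1)
    by (simp add: diff_frac_eq)
qed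

lemma hdist_mob:
  assumes "mdet A = 1" "z \<in> hplane" "w \<in> hplane"
  shows "hdist (mob A z) (mob A w) = hdist z w"
proof -
  obtain a b c d where A: "A = (a, b, c, d)" by (cases A)
  have det: "a * d - b * c = 1" using assms(1) A by simp
  define p q where "p = of_real c * z + of_real d" and "q = of_real c * w + of_real d"
  have "p \<noteq> 0" "q \<noteq> 0"
    using mob_denominator[OF det] assms by (simp_all add: p_def q_def)
  then have nz: "cmod p \<noteq> 0" "cmod q \<noteq> 0" "Im z \<noteq> 0" "Im w \<noteq> 0"
    using assms by (simp_all add: hplane_def)
  have "(cmod (mob A z - mob A w))\<^sup>2 / (2 * Im (mob A z) * Im (mob A w))
      = (cmod (z - w))\<^sup>2 / (2 * Im z * Im w)"
    unfolding A mob_diff[OF det assms(2,3)] Im_mob[OF det assms(2)] Im_mob[OF det assms(3)]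
      p_def[symmetric] q_def[symmetric]
    using nz by (simp add: norm_divide norm_mult power_divide power_mult_distrib field_simps)
  then show ?thesis by (simp add: hdist_def)
qed

lemma cosh_hdist:
  assumes "z \<in> hplane" "w \<in> hplane"
  shows "cosh (hdist z w) = 1 + (cmod (z - w))\<^sup>2 / (2 * Im z * Im w)"
  using assms unfolding hdist_def hplane_def by (intro cosh_arcosh_real) auto

section \<open>The imaginary axis and the normal form of geodesic lines\<close>

definition vertical :: "real \<Rightarrow> complex" where
  "vertical t = Complex 0 (exp t)"

lemma vertical_in_hplane [simp]: "vertical t \<in> hplane"
  by (simp add: vertical_def hplane_def)

lemma mob_mdiag_vertical: "mob (mdiag (s / 2)) (vertical t) = vertical (t + s)"
proof -
  have "of_real (exp (s / 2)) / of_real (exp (- (s / 2))) = (of_real (exp s) :: complex)"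
    by (simp flip: of_real_divide exp_diff)
  then have "mob (mdiag (s / 2)) (vertical t) = of_real (exp s) * vertical t"
    by (simp add: mdiag_def flip: times_divide_eq_left)
  then show ?thesis
    by (simp add: vertical_def complex_eq_iff exp_add)
qed

lemma hdist_vertical: "hdist (vertical s) (vertical t) = \<bar>s - t\<bar>"
proof -
  have "vertical s - vertical t = \<i> * of_real (exp s - exp t)"
    by (simp add: vertical_def complex_eq_iff)
  then have "(cmod (vertical s - vertical t))\<^sup>2 = (exp s - exp t)\<^sup>2"
    by (simp add: norm_mult flip: of_real_diff)
  then have "1 + (cmod (vertical s - vertical t))\<^sup>2 / (2 * Im (vertical s) * Im (vertical t))
      = (exp s / exp t + exp t / exp s) / 2"
    by (simp add: vertical_def field_simps power2_eq_square)
  also have "\<dots> = cosh (s - t)"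
    by (simp add: cosh_field_def exp_diff)
  finally show ?thesis
    using arcosh_cosh_real[of "\<bar>s - t\<bar>"] by (simp add: hdist_def)
qed

text \<open>Real and imaginary parts of the fixed point equation at \<open>vertical u\<close> give
  \<open>a = d\<close> and b = -exp(2 u) c; two different values of \<open>u\<close> force
  \<open>c = 0\<close>.\<close>

lemma mob_fix_vertical:
  assumes "mdet A = 1" "s \<noteq> t" "mob A (vertical s) = vertical s" "mob A (vertical t) = vertical t"
  shows "A = mone \<or> A = - mone"
proof -
  obtain a b c d where A: "A = (a, b, c, d)" by (cases A)
  have det: "a * d - b * c = 1" using assms(1) A by simp
  have eqs: "b = - (exp u * exp u * c) \<and> a = d" if "mob A (vertical u) = vertical u" for u
  proof -
    have "of_real c * vertical u + of_real d \<noteq> 0"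
      using mob_denominator[OF det] by simp
    then have "of_real a * vertical u + of_real b = vertical u * (of_real c * vertical u + of_real d)"
      using that unfolding A by (simp add: field_simps)
    then show ?thesis
      by (simp add: vertical_def complex_eq_iff)
  qed
  have "exp s * exp s * c = exp t * exp t * c"
    using eqs[OF assms(3)] eqs[OF assms(4)] by auto
  moreover have "exp s * exp s \<noteq> exp t * exp t"
    using assms(2) by (simp flip: exp_add)
  ultimately have "c = 0" by simp
  moreover from this have "b = 0" "a = d" using eqs[OF assms(3)] by auto
  ultimately have "a = 1 \<or> a = - 1"
    using det by (simp add: square_eq_1_iff)
  then show ?thesis
    unfolding A using \<open>c = 0\<close> \<open>b = 0\<close> \<open>a = d\<close> by (auto simp: mone_def)
qed

lemma vertical_distances_determine:
  assumes z: "z \<in> hplane" and w: "w \<in> hplane"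
    and "hdist z (vertical 0) = hdist w (vertical 0)"
    and "hdist z (vertical (ln 2)) = hdist w (vertical (ln 2))"
  shows "Im z = Im w" "\<bar>Re z\<bar> = \<bar>Re w\<bar>"
proof -
  \<comment> \<open>\<open>p z\<close> is twice the hyperbolic cosine of the distance to i, and
    \<open>q z\<close> four times that of the distance to 2 i. Their difference recovers the height,
    and then only a reflection in the axis remains open.\<close>
  define p where "p z = ((Re z)\<^sup>2 + (Im z)\<^sup>2 + 1) / Im z" for z
  define q where "q z = ((Re z)\<^sup>2 + (Im z)\<^sup>2 + 4) / Im z" for z
  have p: "cosh (hdist z (vertical 0)) = p z / 2" and q: "cosh (hdist z (vertical (ln 2))) = q z / 4"
    if "z \<in> hplane" for z
    using that
    by (simp_all add: cosh_hdist p_def q_def vertical_def cmod_power2 hplane_def field_simps power2_diff)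
  have pos: "Im z > 0" "Im w > 0" using z w by (auto simp: hplane_def)
  have eqs: "p z = p w" "q z = q w"
    using assms p q by (metis divide_cancel_right zero_neq_numeral)+
  have "q z - p z = 3 / Im z" "q w - p w = 3 / Im w"
    using pos by (simp_all add: p_def q_def flip: diff_divide_distrib)
  then show Im: "Im z = Im w"
    using eqs pos by simp
  then have "(Re z)\<^sup>2 = (Re w)\<^sup>2"
    using eqs(1) pos by (simp add: p_def)
  then show "\<bar>Re z\<bar> = \<bar>Re w\<bar>"
    by (simp add: power2_eq_iff abs_eq_iff)
qed

text \<open>The rotations about i are the matrices (a, b, -b, a) with a^2 + b^2 = 1. They carry 2 i
  to the point with imaginary part 2 / (1 + 3 b^2) and real part -3 a b / (1 + 3 b^2), which is
  solved for \<open>a\<close> and \<open>b\<close>.\<close>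

lemma mob_transitive_i:
  assumes "q \<in> hplane" "hdist (vertical 0) q = ln 2"
  shows "\<exists>A. mdet A = 1 \<and> mob A (vertical 0) = vertical 0 \<and> mob A (vertical (ln 2)) = q"
proof -
  define x y where "x = Re q" and "y = Im q"
  have y: "y > 0" using assms(1) by (simp add: y_def hplane_def)
  have "1 + (cmod (vertical 0 - q))\<^sup>2 / (2 * Im (vertical 0) * Im q) = 5 / 4"
    unfolding cosh_hdist[OF vertical_in_hplane assms(1), symmetric] assms(2)
    by (simp add: cosh_ln_real)
  then have "x\<^sup>2 + (1 - y)\<^sup>2 = y / 2"
    using y by (simp add: vertical_def cmod_power2 x_def[symmetric] y_def[symmetric] field_simps)
  \<comment> \<open>The Euclidean equation of the hyperbolic circle of radius \<open>ln 2\<close>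
    about i. It confines \<open>y\<close> to [1/2, 2], so that \<open>b\<close> is real and at most
    1.\<close>
  then have x2: "x\<^sup>2 = (2 - y) * (y - 1 / 2)"
    by (simp add: power2_eq_square field_simps)
  then have "0 \<le> (2 - y) * (y - 1 / 2)"
    by (metis zero_le_power2)
  then have y2: "1 / 2 \<le> y" "y \<le> 2"
    unfolding zero_le_mult_iff by auto
  define b where "b = sqrt ((2 / y - 1) / 3)"
  \<comment> \<open>Since \<open>b\<close> is nonnegative, \<open>ab\<close> forces the sign of
    \<open>a\<close> to be opposite to that of \<open>x\<close>.\<close>
  define a where "a = (if x \<ge> 0 then - 1 else 1) * sqrt (1 - b\<^sup>2)"
  have b2: "b\<^sup>2 = (2 / y - 1) / 3"
    using y y2 by (simp add: b_def field_simps)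
  have "2 / y \<le> 4" using y y2 by (simp add: field_simps)
  then have b1: "b\<^sup>2 \<le> 1" unfolding b2 by simp
  then have a2: "a\<^sup>2 = 1 - b\<^sup>2"
    by (simp add: a_def power_mult_distrib)
  have ab: "- 3 * a * b * y = 2 * x"
  proof -
    have "(- 3 * a * b * y)\<^sup>2 = 9 * (1 - b\<^sup>2) * b\<^sup>2 * y\<^sup>2"
      using a2 by (simp add: power_mult_distrib)
    also have "\<dots> = (2 * x)\<^sup>2"
      using y unfolding b2 power_mult_distrib x2 by (simp add: field_simps power2_eq_square)
    finally have "\<bar>- 3 * a * b * y\<bar> = \<bar>2 * x\<bar>"
      by (metis power2_eq_iff abs_eq_iff)
    moreover have "b \<ge> 0" using y y2 by (simp add: b_def)
    moreover have "sgn x * (a * b) \<le> 0"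
      using \<open>b \<ge> 0\<close> b1 by (simp add: a_def sgn_if mult_nonneg_nonneg)
    ultimately show ?thesis
      using y by (cases "x \<ge> 0") (auto simp: abs_mult a_def b1)
  qed
  have y_eq: "y * (1 + 3 * b\<^sup>2) = 2"
    using y unfolding b2 by (simp add: field_simps)
  have q: "q = Complex x y" by (simp add: x_def y_def)
  define A where "A = (a, b, - b, a)"
  have det: "a * a - b * (- b) = 1" using a2 by (simp add: power2_eq_square)
  have n: "of_real (- b) * vertical t + of_real a \<noteq> 0" for t
    using mob_denominator[OF det] by simp
  have "mob A (vertical 0) = vertical 0"
  proof -
    have "of_real a * vertical 0 + of_real b = vertical 0 * (of_real (- b) * vertical 0 + of_real a)"
      by (simp add: vertical_def complex_eq_iff)
    then show ?thesis using n[of 0] by (simp add: A_def field_simps)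
  qed
  moreover have "mob A (vertical (ln 2)) = q"
  proof -
    have "2 * a = y * a - 2 * (x * b)" "b = x * a + 2 * (y * b)"
    proof -
      have aa: "a * a = 1 - b * b" using a2 by (simp add: power2_eq_square)
      have yb: "y + 3 * (y * (b * b)) = 2" using y_eq by (simp add: power2_eq_square algebra_simps)
      have "y * a - 2 * (x * b) = a * (y + 3 * (y * (b * b)))"
        using ab by algebra
      then show "2 * a = y * a - 2 * (x * b)" using yb by simp
      have "2 * (x * a) = - 3 * (a * a) * b * y" using ab by algebra
      also have "\<dots> = - 3 * y * b + b * (3 * (y * (b * b)))" unfolding aa by (simp add: algebra_simps)
      also have "3 * (y * (b * b)) = 2 - y" using yb by simp
      finally show "b = x * a + 2 * (y * b)" by (simp add: algebra_simps)
    qed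
    then have "of_real a * vertical (ln 2) + of_real b
        = q * (of_real (- b) * vertical (ln 2) + of_real a)"
      by (simp add: vertical_def complex_eq_iff q algebra_simps)
    then show ?thesis using n[of "ln 2"] by (simp add: A_def field_simps)
  qed
  moreover have "mdet A = 1" using det by (simp add: A_def)
  ultimately show ?thesis by blast
qed

lemma mob_transitive:
  assumes p: "p \<in> hplane" and q: "q \<in> hplane" and "hdist p q = ln 2"
  shows "\<exists>A. mdet A = 1 \<and> mob A (vertical 0) = p \<and> mob A (vertical (ln 2)) = q"
proof -
  define s where "s = sqrt (Im p)"
  have s: "s > 0" "s * s = Im p" using p by (auto simp: s_def hplane_def)
  \<comment> \<open>\<open>B\<close> multiplies by \<open>Im p\<close> and adds \<open>Re p\<close>,
    so it carries i to \<open>p\<close> and leaves a rotation about i to be found.\<close>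
  define B :: mat2 where "B = (s, Re p / s, 0, 1 / s)"
  have B: "mdet B = 1" using s by (simp add: B_def)
  have Bp: "mob B (vertical 0) = p"
    using s by (simp add: B_def vertical_def complex_eq_iff field_simps)
  define q' where "q' = mob (madj B) q"
  have q': "q' \<in> hplane" "mob B q' = q"
    using B q by (auto simp: q'_def mob_madj_cancel)
  have "hdist (vertical 0) q' = ln 2"
    using hdist_mob[OF B vertical_in_hplane[of 0] q'(1)] assms(3) Bp q'(2) by simp
  from mob_transitive_i[OF q'(1) this] obtain A where
    "mdet A = 1" "mob A (vertical 0) = vertical 0" "mob A (vertical (ln 2)) = q'"
    by blast
  then have "mdet (mmul B A) = 1" "mob (mmul B A) (vertical 0) = p"
    "mob (mmul B A) (vertical (ln 2)) = q"
    using B Bp q' by (simp_all add: mob_mmul)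
  then show ?thesis by blast
qed

text \<open>A Moebius map matches the points at parameters 0 and \<open>ln 2\<close>. Pulled back,
  the point at \<open>t\<close> has the same distances to these two as \<open>vertical t\<close>,
  and the reflection ambiguity is harmless on the axis.\<close>

lemma geodesic_line_eq_mob:
  assumes "geodesic_line \<sigma>"
  shows "\<exists>A. mdet A = 1 \<and> (\<forall>t. \<sigma> t = mob A (vertical t))"
proof -
  have in_hplane: "\<sigma> t \<in> hplane" for t using assms by (auto simp: geodesic_line_def)
  have dist: "hdist (\<sigma> s) (\<sigma> t) = \<bar>s - t\<bar>" for s t using assms by (simp add: geodesic_line_def)
  obtain A where A: "mdet A = 1" "mob A (vertical 0) = \<sigma> 0" "mob A (vertical (ln 2)) = \<sigma> (ln 2)"
    using mob_transitive[OF in_hplane in_hplane, of 0 "ln 2"] dist by auto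
  have "\<sigma> t = mob A (vertical t)" for t
  proof -
    define w where "w = mob (madj A) (\<sigma> t)"
    have w: "w \<in> hplane" "mob A w = \<sigma> t"
      using A in_hplane by (auto simp: w_def mob_madj_cancel)
    have "hdist w (vertical s) = hdist (vertical t) (vertical s)" if "s \<in> {0, ln 2}" for s :: real
      using hdist_mob[OF A(1) w(1) vertical_in_hplane, of s] that A(2,3) w(2)
      by (auto simp: dist hdist_vertical)
    then have "Im w = Im (vertical t)" "\<bar>Re w\<bar> = \<bar>Re (vertical t)\<bar>"
      using vertical_distances_determine[OF w(1) vertical_in_hplane[of t]] by simp_all
    then have "w = vertical t"
      by (simp add: complex_eq_iff vertical_def)
    then show ?thesis using w(2) by simp
  qed
  then show ?thesis using A(1) by blast
qed

section \<open>Isometries and orientation\<close>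

lemma isometry_fixing_vertical:
  assumes f: "\<And>z. z \<in> hplane \<Longrightarrow> f z \<in> hplane"
    and dist: "\<And>z w. z \<in> hplane \<Longrightarrow> w \<in> hplane \<Longrightarrow> hdist (f z) (f w) = hdist z w"
    and fixed: "f (vertical 0) = vertical 0" "f (vertical (ln 2)) = vertical (ln 2)"
  shows "(\<forall>z\<in>hplane. f z = z) \<or> (\<forall>z\<in>hplane. f z = - cnj z)"
proof -
  have coords: "Im (f z) = Im z" "\<bar>Re (f z)\<bar> = \<bar>Re z\<bar>" if "z \<in> hplane" for z
    using vertical_distances_determine[of "f z" z] f dist[of z "vertical 0"]
      dist[of z "vertical (ln 2)"] that by (simp_all add: fixed)
  \<comment> \<open>So far each point is fixed or reflected on its own. Distances to the image of
    one point off the axis decide the choice for all points at once.\<close>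
  define e where "e = Complex 1 1"
  have e: "e \<in> hplane" by (simp add: e_def hplane_def)
  have sq: "(Re (f z) - Re (f e))\<^sup>2 = (Re z - 1)\<^sup>2" if z: "z \<in> hplane" for z
  proof -
    have "cosh (hdist (f z) (f e)) = cosh (hdist z e)" using dist[OF z e] by simp
    then have "(cmod (f z - f e))\<^sup>2 = (cmod (z - e))\<^sup>2"
      using z e f by (simp add: cosh_hdist coords) (simp add: hplane_def)
    then show ?thesis
      using coords[OF z] coords[OF e] by (simp add: cmod_power2 e_def)
  qed
  have "Re (f e) = 1 \<or> Re (f e) = - 1"
    using coords(2)[OF e] by (auto simp: e_def)
  then show ?thesis
  proof
    assume fe: "Re (f e) = 1"
    have "f z = z" if z: "z \<in> hplane" for z
      using coords[OF z] sq[OF z] fe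
      by (auto simp: complex_eq_iff abs_eq_iff power2_eq_square algebra_simps)
    then show ?thesis by blast
  next
    assume fe: "Re (f e) = - 1"
    have "f z = - cnj z" if z: "z \<in> hplane" for z
      using coords[OF z] sq[OF z] fe
      by (auto simp: complex_eq_iff abs_eq_iff power2_eq_square algebra_simps)
    then show ?thesis by blast
  qed
qed

lemma isometry_cases:
  assumes f: "\<And>z. z \<in> hplane \<Longrightarrow> f z \<in> hplane"
    and dist: "\<And>z w. z \<in> hplane \<Longrightarrow> w \<in> hplane \<Longrightarrow> hdist (f z) (f w) = hdist z w"
  obtains (preserving) A where "mdet A = 1" "\<And>z. z \<in> hplane \<Longrightarrow> f z = mob A z"
  | (reversing) A where "mdet A = 1" "\<And>z. z \<in> hplane \<Longrightarrow> f z = mob A (- cnj z)"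
proof -
  have "hdist (f (vertical 0)) (f (vertical (ln 2))) = ln 2"
    by (simp add: dist hdist_vertical)
  then obtain A where A: "mdet A = 1" "mob A (vertical 0) = f (vertical 0)"
    "mob A (vertical (ln 2)) = f (vertical (ln 2))"
    using mob_transitive[OF f f] by (metis vertical_in_hplane)
  define g where "g z = mob (madj A) (f z)" for z
  have g: "g z \<in> hplane" "mob A (g z) = f z" if "z \<in> hplane" for z
    using that f A(1) by (auto simp: g_def mob_madj_cancel)
  have "(\<forall>z\<in>hplane. g z = z) \<or> (\<forall>z\<in>hplane. g z = - cnj z)"
  proof (rule isometry_fixing_vertical)
    show "g z \<in> hplane" if "z \<in> hplane" for z using g that by simp
    show "hdist (g z) (g w) = hdist z w" if "z \<in> hplane" "w \<in> hplane" for z w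
      using that f dist A(1) by (simp add: g_def hdist_mob)
    show "g (vertical 0) = vertical 0" "g (vertical (ln 2)) = vertical (ln 2)"
      unfolding g_def A(2,3)[symmetric] by (simp_all add: mob_madj_cancel A(1))
  qed
  then show ?thesis
    using that(1)[OF A(1)] that(2)[OF A(1)] g by metis
qed

lemma has_field_derivative_mob:
  assumes "a * d - b * c = 1" "z \<in> hplane"
  shows "(mob (a, b, c, d) has_field_derivative 1 / (of_real c * z + of_real d)\<^sup>2) (at z)"
proof -
  define q where "q = of_real c * z + of_real d"
  have q: "q \<noteq> 0"
    using mob_denominator[OF assms] by (simp add: q_def)
  have "of_real a * q - (of_real a * z + of_real b) * of_real c = of_real (a * d - b * c)"
    by (simp add: q_def algebra_simps)
  then have num: "of_real a * q - (of_real a * z + of_real b) * of_real c = 1"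
    by (simp add: assms(1))
  have "((\<lambda>z. (of_real a * z + of_real b) / (of_real c * z + of_real d)) has_field_derivative
      (of_real a * q - (of_real a * z + of_real b) * of_real c) / (q * q)) (at z)"
    using q unfolding q_def by (auto intro!: derivative_eq_intros)
  moreover have "mob (a, b, c, d) = (\<lambda>z. (of_real a * z + of_real b) / (of_real c * z + of_real d))"
    by (simp add: fun_eq_iff)
  ultimately show ?thesis
    unfolding num q_def[symmetric] by (simp add: power2_eq_square)
qed

lemma open_hplane: "open hplane"
  unfolding hplane_def by (rule open_halfspace_Im_gt)

text \<open>By the chain rule the derivative sends \<open>w\<close> to \<open>m * (- cnj w)\<close>,
  with \<open>m\<close> the complex derivative of the Moebius map; its real determinant is
  -|m|^2.\<close>

lemma jacobian_reversing:
  assumes "mdet A = 1" "z \<in> hplane" "\<And>z. z \<in> hplane \<Longrightarrow> g z = mob A (- cnj z)"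
  shows "jacobian g z < 0"
proof -
  obtain a b c d where A: "A = (a, b, c, d)" by (cases A)
  have det: "a * d - b * c = 1" using assms(1) A by simp
  have z': "- cnj z \<in> hplane" using assms(2) by (simp add: hplane_def)
  define m where "m = 1 / (of_real c * (- cnj z) + of_real d)\<^sup>2"
  have "m \<noteq> 0" using mob_denominator[OF det z'] by (simp add: m_def)
  have "(mob A has_derivative (*) m) (at (- cnj z))"
    using has_field_derivative_mob[OF det z'] unfolding A m_def has_field_derivative_def .
  moreover have "((\<lambda>w. - cnj w) has_derivative (\<lambda>w. - cnj w)) (at z)"
    by (intro derivative_intros has_derivative_cnj has_derivative_ident)
  ultimately have "((\<lambda>w. mob A (- cnj w)) has_derivative (\<lambda>w. m * (- cnj w))) (at z)"
    by (rule has_derivative_compose[rotated])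
  then have "(g has_derivative (\<lambda>w. m * (- cnj w))) (at z)"
    by (rule has_derivative_transform_within_open[OF _ open_hplane assms(2)]) (simp add: assms(3))
  then have "frechet_derivative g (at z) = (\<lambda>w. m * (- cnj w))"
    by (rule frechet_derivative_at[symmetric])
  then have "jacobian g z = - (Re m * Re m + Im m * Im m)"
    by (simp add: jacobian_def algebra_simps)
  then have "jacobian g z = - (cmod m)\<^sup>2"
    unfolding cmod_power2 by (simp add: power2_eq_square)
  then show ?thesis using \<open>m \<noteq> 0\<close> by simp
qed

section \<open>Covering translations as matrices\<close>

text \<open>Each point is tagged by a basic open set that meets \<open>S\<close> in that point
  alone, and there are countably many tags.\<close>

lemma discrete_imp_countable:
  fixes S :: "'a :: second_countable_topology set"
  assumes "discrete S"
  shows "countable S"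
proof -
  obtain B :: "'a set set" where B: "countable B" "topological_basis B"
    using ex_countable_basis by blast
  have "\<exists>b\<in>B. b \<inter> S = {x}" if x: "x \<in> S" for x
  proof -
    obtain T where T: "open T" "T \<inter> S = {x}"
      using discreteD[OF assms x] by (auto simp: isolated_in_def)
    obtain b where "b \<in> B" "x \<in> b" "b \<subseteq> T"
      using topological_basisE[OF B(2) T(1), of x] T(2) by blast
    then show ?thesis using T(2) x by blast
  qed
  then obtain f where f: "\<And>x. x \<in> S \<Longrightarrow> f x \<in> B \<and> f x \<inter> S = {x}"
    by metis
  have "inj_on f S"
    using f by (metis inj_onI singleton_inject)
  moreover have "countable (f ` S)"
    by (rule countable_subset[OF _ B(1)]) (use f in blast)
  ultimately show ?thesis
    using countable_image_inj_on by blast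
qed

context sl2_discrete
begin

lemma discrete: "discrete G"
proof (rule discreteI, rule ccontr)
  fix A assume A: "A \<in> G" "\<not> A isolated_in G"
  then have "A islimpt G"
    by (simp add: isolated_in_islimpt_iff)
  then obtain f where f: "\<And>n. f n \<in> G - {A}" "f \<longlonglongrightarrow> A"
    unfolding islimpt_sequential by blast
  have "(\<lambda>n. mmul (madj A) (f n)) \<longlonglongrightarrow> mmul (madj A) A"
    by (intro tendsto_intros f)
  then have "eventually (\<lambda>n. mmul (madj A) (f n) = mone) sequentially"
    unfolding mmul_madj[OF det[OF A(1)]] by (rule eventually_one) (use f A in \<open>auto intro: mul adj\<close>)
  then obtain n where "mmul (madj A) (f n) = mone"
    by (auto simp: eventually_sequentially)
  then have "f n = A"
    using mmul_madj_cancel(1)[OF det[OF A(1)], of "f n"] by simp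
  then show False using f(1) by blast
qed

text \<open>Used with \<open>M\<close> carrying the imaginary axis to \<open>l\<close>, so that the
  translation along \<open>l\<close> becomes diagonal. Isolation survives because conjugation is
  continuous and injective.\<close>

lemma conjugate:
  assumes M: "mdet M = 1"
  shows "sl2_discrete {A. mmul M (mmul A (madj M)) \<in> G}"
proof
  define c where "c A = mmul M (mmul A (madj M))" for A
  have c_inv: "mmul (madj M) (mmul (c A) M) = A" for A
    using M by (simp add: c_def mmul_assoc mmul_madj mmul_madj_cancel)
  have c_mul: "c (mmul A B) = mmul (c A) (c B)" for A B
    using M by (simp add: c_def mmul_assoc mmul_madj_cancel)
  have c_adj: "c (madj A) = madj (c A)" for A
    by (simp add: c_def madj_mmul mmul_assoc)
  have c_minus: "c (- A) = - c A" for A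
    by (simp add: c_def mmul_uminus)
  have c_one: "c mone = mone"
    using M by (simp add: c_def mmul_madj)
  have c_pow: "c (mpow A n) = mpow (c A) n" for A n
    by (induction n) (simp_all add: c_one c_mul)
  have c_inj: "c A = c B \<longleftrightarrow> A = B" for A B
    using c_inv by metis
  fix A B
  show "A \<in> {A. mmul M (mmul A (madj M)) \<in> G} \<Longrightarrow> mdet A = 1"
    using det[of "c A"] M by (simp add: c_def)
  show "mmul A B \<in> {A. mmul M (mmul A (madj M)) \<in> G}"
    if "A \<in> {A. mmul M (mmul A (madj M)) \<in> G}" "B \<in> {A. mmul M (mmul A (madj M)) \<in> G}"
    using mul that unfolding c_def[symmetric] by (simp add: c_mul)
  show "madj A \<in> {A. mmul M (mmul A (madj M)) \<in> G}" if "A \<in> {A. mmul M (mmul A (madj M)) \<in> G}"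
    using adj that unfolding c_def[symmetric] by (simp add: c_adj)
  show "- A \<in> {A. mmul M (mmul A (madj M)) \<in> G}" if "A \<in> {A. mmul M (mmul A (madj M)) \<in> G}"
    using minus that unfolding c_def[symmetric] by (simp add: c_minus)
  show "A = mone \<or> A = - mone"
    if "A \<in> {A. mmul M (mmul A (madj M)) \<in> G}" "n > 0" "mpow A n = mone" for n
  proof -
    have "mpow (c A) n = mone" using that c_pow[of A n] c_one by simp
    then have "c A = c mone \<or> c A = c (- mone)"
      using torsion_free[of "c A" n] that unfolding c_def[symmetric] by (simp add: c_one c_minus)
    then show ?thesis by (simp add: c_inj)
  qed
  show "mone isolated_in {A. mmul M (mmul A (madj M)) \<in> G}"
    unfolding c_def[symmetric]
  proof (rule ccontr)
    assume "\<not> mone isolated_in {A. c A \<in> G}"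
    then have "mone islimpt {A. c A \<in> G}"
      using one by (simp add: isolated_in_islimpt_iff c_one)
    then obtain f where f: "\<And>n. f n \<in> {A. c A \<in> G} - {mone}" "f \<longlonglongrightarrow> mone"
      unfolding islimpt_sequential by blast
    have "(\<lambda>n. c (f n)) \<longlonglongrightarrow> c mone"
      unfolding c_def by (intro tendsto_intros f)
    then have "eventually (\<lambda>n. c (f n) = mone) sequentially"
      unfolding c_one by (rule eventually_one) (use f in auto)
    then obtain n where "c (f n) = c mone"
      by (auto simp: eventually_sequentially c_one)
    then show False using f(1) by (auto simp: c_inj)
  qed
qed

end

section \<open>From matrices to covering translations\<close>

definition hmob :: "mat2 \<Rightarrow> complex \<Rightarrow> complex" where
  "hmob A = restrict (mob A) hplane"

lemma hmob_apply [simp]: "z \<in> hplane \<Longrightarrow> hmob A z = mob A z"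
  by (simp add: hmob_def)

lemma hmob_in_Bij:
  assumes "mdet A = 1"
  shows "hmob A \<in> Bij hplane"
proof -
  have "bij_betw (mob A) hplane hplane"
    by (rule bij_betw_byWitness[of _ "mob (madj A)"])
      (use assms in \<open>auto simp: mob_madj_cancel\<close>)
  then show ?thesis
    by (simp add: Bij_def hmob_def bij_betw_restrict_eq)
qed

lemma hmob_mmul:
  assumes "mdet A = 1" "mdet B = 1"
  shows "hmob A \<otimes>\<^bsub>BijGroup hplane\<^esub> hmob B = hmob (mmul A B)"
  using assms hmob_in_Bij by (auto simp: BijGroup_def compose_def hmob_def mob_mmul fun_eq_iff)

lemma hmob_mone: "hmob mone = \<one>\<^bsub>BijGroup hplane\<^esub>"
  by (auto simp: BijGroup_def hmob_def fun_eq_iff)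

lemma hmob_uminus: "hmob (- A) = hmob A"
  by (auto simp: hmob_def fun_eq_iff)

lemma hmob_madj:
  assumes "mdet A = 1"
  shows "hmob (madj A) = inv\<^bsub>BijGroup hplane\<^esub> (hmob A)"
proof -
  have "carrier (BijGroup hplane) = Bij hplane" by (simp add: BijGroup_def)
  then show ?thesis
    using assms
    by (intro group.inv_equality[OF group_BijGroup, symmetric])
      (simp_all add: hmob_mmul mmul_madj hmob_mone hmob_in_Bij)
qed

lemma hmob_mpow:
  assumes "mdet A = 1"
  shows "hmob A [^]\<^bsub>BijGroup hplane\<^esub> n = hmob (mpow A n)"
proof (induction n)
  case (Suc n)
  have "mpow A (Suc n) = mmul (mpow A n) A"
    using mpow_add[of A n 1] by simp
  then show ?case
    using Suc assms by (simp add: hmob_mmul mdet_mpow del: mpow.simps)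
qed (simp add: hmob_mone)

lemma hmob_eq_iff:
  assumes "mdet A = 1" "mdet B = 1"
  shows "hmob A = hmob B \<longleftrightarrow> B = A \<or> B = - A"
proof
  assume eq: "hmob A = hmob B"
  have "mob (mmul (madj A) B) (vertical t) = vertical t" for t
  proof -
    have "mob B (vertical t) = mob A (vertical t)"
      using fun_cong[OF eq, of "vertical t"] by simp
    then show ?thesis using assms by (simp add: mob_mmul mob_madj_cancel)
  qed
  then have "mmul (madj A) B = mone \<or> mmul (madj A) B = - mone"
    using mob_fix_vertical[of "mmul (madj A) B" 0 1] assms by simp
  then have "mmul A (mmul (madj A) B) = A \<or> mmul A (mmul (madj A) B) = - A"
    by (auto simp: mmul_uminus)
  then show "B = A \<or> B = - A"
    by (simp add: mmul_madj_cancel assms)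
qed (auto simp: hmob_uminus)

lemma tendsto_hmob:
  assumes "f \<longlonglongrightarrow> A" "mdet A = 1"
  shows "(\<lambda>n. hmob (f n)) \<longlonglongrightarrow> hmob A"
proof -
  have "(\<lambda>n. hmob (f n) z) \<longlonglongrightarrow> hmob A z" for z
  proof (cases "z \<in> hplane")
    case True
    obtain a b c d where A: "A = (a, b, c, d)" by (cases A)
    have nz: "of_real c * z + of_real d \<noteq> 0"
      using assms(2) A True by (intro mob_denominator) auto
    have eq: "mob B z = (of_real (fst B) * z + of_real (fst (snd B)))
        / (of_real (fst (snd (snd B))) * z + of_real (snd (snd (snd B))))" for B
      by (cases B) simp
    show ?thesis
      using True nz unfolding hmob_apply[OF True] eq
      by (intro tendsto_intros assms(1)) (simp add: A)
  qed (simp add: hmob_def)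
  then show ?thesis
    using limitin_componentwise[of "\<lambda>_. euclidean" UNIV "\<lambda>n. hmob (f n)" "hmob A" sequentially]
    by (simp add: euclidean_product_topology)
qed

text \<open>The half-plane is connected, so the sign function \<open>\<omega>\<close> is constant
  and its transformation rule forces the sign of the Jacobian to be 1.\<close>

lemma orientable_quotient_jacobian:
  assumes "orientable_quotient \<Gamma>" "g \<in> \<Gamma>" "z \<in> hplane" "g z \<in> hplane"
  shows "jacobian g z > 0"
proof -
  obtain \<omega> :: "complex \<Rightarrow> real" where \<omega>: "continuous_on hplane \<omega>" "\<And>z. z \<in> hplane \<Longrightarrow> \<omega> z \<in> {-1, 1}"
    "\<And>z. z \<in> hplane \<Longrightarrow> \<omega> (g z) = sgn (jacobian g z) * \<omega> z"
    using assms(1,2) unfolding orientable_quotient_def by blast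
  have "connected hplane"
    unfolding hplane_def by (intro convex_connected convex_halfspace_Im_gt)
  moreover have "finite (\<omega> ` hplane)"
    by (rule finite_subset[of _ "{-1, 1}"]) (use \<omega>(2) in auto)
  ultimately have "\<omega> constant_on hplane"
    using continuous_finite_range_constant[OF _ \<omega>(1)] by blast
  then have "\<omega> (g z) = \<omega> z"
    using assms by (auto simp: constant_on_def)
  then have "sgn (jacobian g z) = 1"
    using \<omega>(2,3)[OF assms(3)] by auto
  then show ?thesis by (simp add: sgn_1_pos)
qed

text \<open>Both \<open>A\<close> and \<open>- A\<close> are kept, which avoids choosing a lift of
  the group from PSL(2, R) to SL(2, R).\<close>

definition surface_matrices :: "(complex \<Rightarrow> complex) set \<Rightarrow> mat2 set" where
  "surface_matrices \<Gamma> = {A. mdet A = 1 \<and> hmob A \<in> \<Gamma>}"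

lemma surface_group_eq_hmob:
  assumes \<Gamma>: "hyperbolic_surface_group \<Gamma>" "orientable_quotient \<Gamma>" and g: "g \<in> \<Gamma>"
  shows "\<exists>A\<in>surface_matrices \<Gamma>. g = hmob A"
proof -
  have "g \<in> Bij hplane"
    using \<Gamma>(1) g subgroup.subset[of \<Gamma> "BijGroup hplane"]
    by (auto simp: hyperbolic_surface_group_def BijGroup_def)
  then have ext: "g \<in> extensional hplane" and in_hplane: "g z \<in> hplane" if "z \<in> hplane" for z
    using that by (auto simp: Bij_def bij_betw_def)
  have dist: "hdist (g z) (g w) = hdist z w" if "z \<in> hplane" "w \<in> hplane" for z w
    using \<Gamma>(1) g that by (simp add: hyperbolic_surface_group_def)
  from isometry_cases[of g, OF in_hplane dist]
  consider (preserving) A where "mdet A = 1" "\<And>z. z \<in> hplane \<Longrightarrow> g z = mob A z"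
    | (reversing) A where "mdet A = 1" "\<And>z. z \<in> hplane \<Longrightarrow> g z = mob A (- cnj z)"
    by metis
  then show ?thesis
  proof cases
    case (preserving A)
    then have "g = hmob A"
      using ext[OF vertical_in_hplane] by (auto simp: hmob_def fun_eq_iff extensional_def)
    moreover from this have "A \<in> surface_matrices \<Gamma>"
      using preserving(1) g by (simp add: surface_matrices_def)
    ultimately show ?thesis by blast
  next
    case (reversing A)
    then have "jacobian g (vertical 0) < 0"
      by (intro jacobian_reversing) auto
    then show ?thesis
      using orientable_quotient_jacobian[OF \<Gamma>(2) g vertical_in_hplane in_hplane, of 0] by auto
  qed
qed

lemma sl2_discrete_surface_matrices:
  assumes "hyperbolic_surface_group \<Gamma>"
  shows "sl2_discrete (surface_matrices \<Gamma>)"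
proof -
  have sub: "subgroup \<Gamma> (BijGroup hplane)" and disc: "discrete \<Gamma>"
    using assms by (auto simp: hyperbolic_surface_group_def)
  show ?thesis
  proof
    fix A B
    show "A \<in> surface_matrices \<Gamma> \<Longrightarrow> mdet A = 1"
      by (simp add: surface_matrices_def)
    show "mmul A B \<in> surface_matrices \<Gamma>"
      if "A \<in> surface_matrices \<Gamma>" "B \<in> surface_matrices \<Gamma>"
      using that subgroup.m_closed[OF sub, of "hmob A" "hmob B"]
      by (simp add: surface_matrices_def hmob_mmul)
    show "madj A \<in> surface_matrices \<Gamma>" if "A \<in> surface_matrices \<Gamma>"
      using that subgroup.m_inv_closed[OF sub, of "hmob A"]
      by (simp add: surface_matrices_def hmob_madj)
    show "- A \<in> surface_matrices \<Gamma>" if "A \<in> surface_matrices \<Gamma>"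
      using that by (simp add: surface_matrices_def hmob_uminus)
    show "A = mone \<or> A = - mone"
      if A: "A \<in> surface_matrices \<Gamma>" and n: "n > 0" "mpow A n = mone" for n
    proof -
      have "hmob A [^]\<^bsub>BijGroup hplane\<^esub> n = \<one>\<^bsub>BijGroup hplane\<^esub>"
        using A n by (simp add: hmob_mpow surface_matrices_def hmob_mone)
      then have "hmob A = hmob mone"
        using assms A n(1) by (auto simp: hyperbolic_surface_group_def surface_matrices_def hmob_mone)
      then show ?thesis
        using A hmob_eq_iff[of mone A] by (simp add: surface_matrices_def)
    qed
    have one: "hmob mone \<in> \<Gamma>"
      using subgroup.one_closed[OF sub] by (simp add: hmob_mone)
    show "mone isolated_in surface_matrices \<Gamma>"
    proof (rule ccontr)
      assume "\<not> mone isolated_in surface_matrices \<Gamma>"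
      then have "mone islimpt surface_matrices \<Gamma>"
        using one by (simp add: isolated_in_islimpt_iff surface_matrices_def)
      then obtain f where f: "\<And>n. f n \<in> surface_matrices \<Gamma> - {mone}" "f \<longlonglongrightarrow> mone"
        unfolding islimpt_sequential by blast
      obtain T where T: "open T" "T \<inter> \<Gamma> = {hmob mone}"
        using discreteD[OF disc one] by (auto simp: isolated_in_def)
      have "eventually (\<lambda>n. hmob (f n) \<in> T) sequentially"
        using T by (intro topological_tendstoD[OF tendsto_hmob[OF f(2)]]) auto
      \<comment> \<open>\<open>hmob\<close> cannot tell \<open>mone\<close> from
        \<open>- mone\<close>, so the latter is excluded by the convergence of
        \<open>f\<close>.\<close>
      moreover have "eventually (\<lambda>n. f n \<in> - {- mone}) sequentially"
        by (intro topological_tendstoD[OF f(2)]) (auto simp: mone_def)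
      ultimately have "eventually (\<lambda>n. hmob (f n) \<in> T \<and> f n \<noteq> - mone) sequentially"
        by eventually_elim simp
      then obtain n where n: "hmob (f n) \<in> T" "f n \<noteq> - mone"
        by (auto simp: eventually_sequentially)
      then have "hmob (f n) = hmob mone"
        using T(2) f(1)[of n] by (auto simp: surface_matrices_def)
      then show False
        using n f(1)[of n] hmob_eq_iff[of mone "f n"] by (auto simp: surface_matrices_def)
    qed
  qed
qed

text \<open>The element carrying one lift to the other may a priori depend on the point, but some
  element works for two points, because the group is countable and the line is not.\<close>

lemma lifts_differ_by_deck_transformation:
  assumes \<Gamma>: "hyperbolic_surface_group \<Gamma>" "orientable_quotient \<Gamma>"
    and M: "mdet M = 1" and N: "mdet N = 1"
    and proj: "\<And>t. surface_proj \<Gamma> (mob M (vertical t)) = surface_proj \<Gamma> (mob N (vertical t))"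
  shows "mmul N (madj M) \<in> surface_matrices \<Gamma>"
proof -
  interpret sl2_discrete "surface_matrices \<Gamma>"
    by (rule sl2_discrete_surface_matrices[OF \<Gamma>(1)])
  have "\<exists>A\<in>surface_matrices \<Gamma>. mob A (mob M (vertical t)) = mob N (vertical t)" for t
  proof -
    have "mob N (vertical t) = hmob mone (mob N (vertical t))"
      using N by (simp add: mob_in_hplane)
    moreover have "hmob mone \<in> \<Gamma>"
      using one by (simp add: surface_matrices_def)
    ultimately have "mob N (vertical t) \<in> surface_proj \<Gamma> (mob N (vertical t))"
      unfolding surface_proj_def by (rule image_eqI)
    then have "mob N (vertical t) \<in> surface_proj \<Gamma> (mob M (vertical t))"
      by (simp add: proj)
    then obtain g where g: "g \<in> \<Gamma>" "g (mob M (vertical t)) = mob N (vertical t)"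
      by (auto simp: surface_proj_def)
    obtain A where "A \<in> surface_matrices \<Gamma>" "g = hmob A"
      using surface_group_eq_hmob[OF \<Gamma> g(1)] by blast
    then show ?thesis
      using g(2) M by (intro bexI[of _ A]) (simp_all add: mob_in_hplane)
  qed
  then obtain A where A: "\<And>t. A t \<in> surface_matrices \<Gamma>"
    "\<And>t. mob (A t) (mob M (vertical t)) = mob N (vertical t)"
    by metis
  have "\<not> inj A"
  proof
    assume "inj A"
    moreover have "countable (range A)"
      by (rule countable_subset[OF _ discrete_imp_countable[OF discrete]]) (use A in blast)
    ultimately have "countable (UNIV :: real set)"
      using countable_image_inj_on by blast
    then show False by (simp add: uncountable_UNIV_real)
  qed
  then obtain s t where st: "s \<noteq> t" "A s = A t"
    by (auto simp: inj_def)
  define B where "B = A s"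
  have B: "B \<in> surface_matrices \<Gamma>" "mdet B = 1"
    using A det by (auto simp: B_def)
  \<comment> \<open>Agreement at the two parameters \<open>s\<close> and \<open>t\<close> already
    determines \<open>B\<close> up to sign, so that \<open>B\<close> carries the whole first lift to
    the second.\<close>
  have fixed: "mob (mmul (madj N) (mmul B M)) (vertical u) = vertical u" if "u \<in> {s, t}" for u
  proof -
    have "mob B (mob M (vertical u)) = mob N (vertical u)"
      using A(2)[of u] st that by (auto simp: B_def)
    then show ?thesis
      using M N B by (simp add: mob_mmul mob_in_hplane mob_madj_cancel)
  qed
  have "mmul (madj N) (mmul B M) = mone \<or> mmul (madj N) (mmul B M) = - mone"
    using mob_fix_vertical[OF _ st(1) fixed fixed] M N B by simp
  then have "mmul N (mmul (madj N) (mmul B M)) = N \<or> mmul N (mmul (madj N) (mmul B M)) = - N"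
    by (auto simp: mmul_uminus)
  then have "mmul B M = N \<or> mmul B M = - N"
    using N by (simp add: mmul_madj_cancel)
  then have "mmul (mmul B M) (madj M) = mmul N (madj M) \<or> mmul (mmul B M) (madj M) = - mmul N (madj M)"
    by (auto simp: mmul_uminus)
  then have "B = mmul N (madj M) \<or> B = - mmul N (madj M)"
    using M by (simp add: mmul_assoc mmul_madj)
  then show ?thesis
    using B(1) minus[OF B(1)] by auto
qed

section \<open>Projection to a geodesic line\<close>

text \<open>The hyperbolic cosine of the distance to \<open>vertical s\<close> is a positive
  multiple of |z|^2 exp(-s) + exp(s), which is minimal only at exp(s) = |z|. The foot of the
  perpendicular thus lies on the Euclidean circle about 0 through \<open>z\<close>.\<close>

lemma nearest_point_on_vertical:
  assumes z: "z \<in> hplane" and le: "hdist z (vertical t) \<le> hdist z (vertical (ln (cmod z)))"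
  shows "t = ln (cmod z)"
proof -
  have r: "cmod z > 0" and y: "Im z > 0"
    using z by (auto simp: hplane_def)
  have cosh: "cosh (hdist z (vertical s)) = ((cmod z)\<^sup>2 / exp s + exp s) / (2 * Im z)" for s
    unfolding cosh_hdist[OF z vertical_in_hplane] cmod_power2 using y
    by (simp add: vertical_def field_simps power2_eq_square)
  have "hdist z w \<ge> 0" if "w \<in> hplane" for w
    using that z unfolding hdist_def hplane_def by (intro arcosh_nonneg_real) auto
  then have "cosh (hdist z (vertical t)) \<le> cosh (hdist z (vertical (ln (cmod z))))"
    using le by (subst cosh_real_nonneg_le_iff) auto
  then have "(cmod z)\<^sup>2 / exp t + exp t \<le> 2 * cmod z"
    unfolding cosh using y r by (simp add: divide_right_mono power2_eq_square divide_le_cancel)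
  then have "(cmod z - exp t)\<^sup>2 \<le> 0"
    by (simp add: field_simps power2_eq_square)
  then have "cmod z = exp t" by simp
  then show ?thesis by simp
qed

lemma cmod_mob_vertical:
  assumes "a * d - b * c = 1"
  shows "(cmod (mob (a, b, c, d) (vertical t)))\<^sup>2 =
    ((a * exp t)\<^sup>2 + b\<^sup>2) / ((c * exp t)\<^sup>2 + d\<^sup>2)"
  by (simp add: norm_divide power_divide cmod_power2 vertical_def add.commute)

text \<open>The image of the imaginary axis has the end points a/c and b/d. The squared modulus of
  any of its points is a weighted mean of their squares, so its logarithm stays between ln |a/c| and
  ln |b/d|.\<close>

lemma ln_cmod_mob_vertical_diff:
  assumes det: "a * d - b * c = 1" and nz: "a \<noteq> 0" "b \<noteq> 0" "c \<noteq> 0" "d \<noteq> 0"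
  shows "\<bar>ln (cmod (mob (a, b, c, d) (vertical s))) - ln (cmod (mob (a, b, c, d) (vertical t)))\<bar>
    \<le> \<bar>ln \<bar>a * d / (b * c)\<bar>\<bar>"
proof -
  define x y where "x = \<bar>a / c\<bar>" and "y = \<bar>b / d\<bar>"
  have pos: "x > 0" "y > 0" using nz by (auto simp: x_def y_def)
  have bounds: "min (ln x) (ln y) \<le> ln r \<and> ln r \<le> max (ln x) (ln y)"
    if r: "r = cmod (mob (a, b, c, d) (vertical u))" for r u
  proof -
    define e where "e = exp u"
    have e: "e > 0" by (simp add: e_def)
    have "mob (a, b, c, d) (vertical u) \<in> hplane"
      using det by (intro mob_in_hplane) auto
    then have r0: "r > 0" using r by (auto simp: hplane_def)
    have den: "(c * e)\<^sup>2 + d\<^sup>2 > 0" using nz by (simp add: sum_power2_gt_zero_iff)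
    have r2: "r\<^sup>2 = ((a * e)\<^sup>2 + b\<^sup>2) / ((c * e)\<^sup>2 + d\<^sup>2)"
      unfolding r cmod_mob_vertical[OF det] e_def ..
    have num: "(a * e)\<^sup>2 + b\<^sup>2 = x\<^sup>2 * (c * e)\<^sup>2 + y\<^sup>2 * d\<^sup>2"
      using nz by (simp add: x_def y_def power_divide power_mult_distrib)
    have "(min x y)\<^sup>2 * ((c * e)\<^sup>2 + d\<^sup>2) \<le> (a * e)\<^sup>2 + b\<^sup>2"
      unfolding num distrib_left using pos by (intro add_mono mult_right_mono power_mono) auto
    then have "(min x y)\<^sup>2 \<le> r\<^sup>2"
      unfolding r2 using den by (simp add: pos_le_divide_eq)
    moreover have "(a * e)\<^sup>2 + b\<^sup>2 \<le> (max x y)\<^sup>2 * ((c * e)\<^sup>2 + d\<^sup>2)"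
      unfolding num distrib_left using pos by (intro add_mono mult_right_mono power_mono) auto
    then have "r\<^sup>2 \<le> (max x y)\<^sup>2"
      unfolding r2 using den by (simp add: pos_divide_le_eq)
    ultimately have "min x y \<le> r" "r \<le> max x y"
      using r0 pos by (auto intro: power2_le_imp_le)
    then show ?thesis
      using r0 pos by (auto simp: min_def max_def split: if_splits)
  qed
  have "ln \<bar>a * d / (b * c)\<bar> = ln (x / y)"
    using nz by (simp add: x_def y_def abs_mult)
  also have "\<dots> = ln x - ln y" using pos by (simp add: ln_div)
  finally show ?thesis
    using bounds[OF refl, of s] bounds[OF refl, of t] by (auto simp: min_def max_def split: if_splits)
qed

theorem theorem5p1:
  fixes \<Gamma> :: "(complex \<Rightarrow> complex) set" and \<gamma> :: "real \<Rightarrow> complex set" and L :: real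
    and l m :: "complex set"
  assumes "hyperbolic_surface_group \<Gamma>" and "orientable_quotient \<Gamma>"
    and "closed_geodesic \<Gamma> \<gamma> L"
    and "l \<in> lines_above \<Gamma> \<gamma>" and "m \<in> lines_above \<Gamma> \<gamma>" and "l \<noteq> m"
  shows "interval_length (orth_proj l m) < ereal L"
proof -
  obtain \<sigma> where l: "l = range \<sigma>" and \<sigma>: "geodesic_line \<sigma>" "\<And>t. surface_proj \<Gamma> (\<sigma> t) = \<gamma> t"
    using assms(4) by (auto simp: lines_above_def)
  obtain \<tau> where m: "m = range \<tau>" and \<tau>: "geodesic_line \<tau>" "\<And>t. surface_proj \<Gamma> (\<tau> t) = \<gamma> t"
    using assms(5) by (auto simp: lines_above_def)
  obtain M where M: "mdet M = 1" "\<And>t. \<sigma> t = mob M (vertical t)"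
    using geodesic_line_eq_mob[OF \<sigma>(1)] by blast
  obtain N where N: "mdet N = 1" "\<And>t. \<tau> t = mob N (vertical t)"
    using geodesic_line_eq_mob[OF \<tau>(1)] by blast
  have L: "L > 0" "\<And>t. \<gamma> (t + L) = \<gamma> t"
    using assms(3) by (auto simp: closed_geodesic_def)
  define G where "G = {A. mmul M (mmul A (madj M)) \<in> surface_matrices \<Gamma>}"
  interpret surface: sl2_discrete "surface_matrices \<Gamma>"
    by (rule sl2_discrete_surface_matrices[OF assms(1)])
  interpret sl2_discrete G
    unfolding G_def by (rule surface.conjugate[OF M(1)])
  interpret sl2_discrete_hyperbolic G L
  proof
    \<comment> \<open>\<open>\<sigma>\<close> and its shift by \<open>L\<close> both lift
      \<open>\<gamma>\<close>, so they differ by a covering translation, namely the translation of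
      \<open>l\<close> by \<open>L\<close>.\<close>
    have "surface_proj \<Gamma> (mob M (vertical t)) = surface_proj \<Gamma> (mob (mmul M (mdiag (L / 2))) (vertical t))" for t
      using \<sigma>(2)[of t] \<sigma>(2)[of "t + L"] L(2)[of t] M by (simp add: mob_mmul mob_mdiag_vertical)
    then have "mmul (mmul M (mdiag (L / 2))) (madj M) \<in> surface_matrices \<Gamma>"
      using M(1) by (intro lifts_differ_by_deck_transformation[OF assms(1,2)]) auto
    then show "mdiag (L / 2) \<in> G"
      by (simp add: G_def mmul_assoc)
  qed (rule L(1))
  \<comment> \<open>In the coordinates given by \<open>N\<close>, the line \<open>m\<close> is the
    imaginary axis and \<open>l\<close> is its image under \<open>W\<close>. Conjugated by
    \<open>M\<close>, \<open>W\<close> is the inverse of the covering translation carrying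
    \<open>l\<close> to \<open>m\<close>.\<close>
  define W where "W = mmul (madj N) M"
  have "mmul N (madj M) \<in> surface_matrices \<Gamma>"
    using M N \<sigma>(2) \<tau>(2) by (intro lifts_differ_by_deck_transformation[OF assms(1,2)]) auto
  then have "mmul (madj M) N \<in> G"
    using M(1) by (simp add: G_def mmul_assoc mmul_madj_cancel)
  then have W: "W \<in> G"
    using adj[of "mmul (madj M) N"] by (simp add: W_def madj_mmul)
  obtain a b c d where abcd: "W = (a, b, c, d)" by (cases W)
  have W_det: "a * d - b * c = 1" using det[OF W] abcd by simp
  have \<sigma>_eq: "\<sigma> s = mob N (mob W (vertical s))" for s
    using M N by (simp add: W_def mob_mmul mob_madj_cancel mob_in_hplane)
  \<comment> \<open>Otherwise \<open>W\<close> is diagonal, and \<open>\<sigma>\<close> is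
    \<open>\<tau>\<close> up to a shift of the parameter.\<close>
  have "b * c \<noteq> 0"
  proof
    assume "b * c = 0"
    then have bc: "b = 0" "c = 0"
      using triangular_imp_diagonal[of a b c d] W abcd by auto
    then have "a * d = 1" using W_det by simp
    then have "a \<noteq> 0" by auto
    with \<open>a * d = 1\<close> have "a * a > 0" "d = 1 / a" by (auto simp: zero_less_mult_iff field_simps)
    then have "mob W (vertical s) = vertical (s + ln (a * a))" for s
      unfolding abcd bc by (simp add: vertical_def complex_eq_iff exp_add)
    then have shift: "\<sigma> s = \<tau> (s + ln (a * a))" for s
      by (simp add: \<sigma>_eq N(2))
    have "\<tau> t = \<sigma> (t - ln (a * a))" for t
      by (simp add: shift)
    with shift have "l = m"
      unfolding l m by (metis (no_types) image_subsetI rangeI subset_antisym)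
    then show False using assms(6) by simp
  qed
  define K where "K = \<bar>ln \<bar>a * d / (b * c)\<bar>\<bar>"
  have "K < L"
    using cross_ratio_bound[of a b c d] W abcd \<open>b * c \<noteq> 0\<close> by (simp add: K_def)
  have proj: "\<exists>s. y = \<tau> (ln (cmod (mob W (vertical s))))" if y: "y \<in> orth_proj l m" for y
  proof -
    obtain s t where st: "y = \<tau> t" "\<And>t'. hdist (\<sigma> s) (\<tau> t) \<le> hdist (\<sigma> s) (\<tau> t')"
      using y unfolding orth_proj_def l m by blast
    have z: "mob W (vertical s) \<in> hplane"
      using det[OF W] by (intro mob_in_hplane) auto
    have "hdist (\<sigma> s) (\<tau> t') = hdist (mob W (vertical s)) (vertical t')" for t'
      unfolding \<sigma>_eq N(2) using hdist_mob[OF N(1) z] by simp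
    then have "t = ln (cmod (mob W (vertical s)))"
      using st(2) by (intro nearest_point_on_vertical[OF z]) simp
    then show ?thesis using st(1) by blast
  qed
  have "interval_length (orth_proj l m) \<le> ereal K"
    unfolding interval_length_def
  proof (intro SUP_least)
    fix x y assume "x \<in> orth_proj l m" "y \<in> orth_proj l m"
    then obtain s t where "x = \<tau> (ln (cmod (mob W (vertical s))))" "y = \<tau> (ln (cmod (mob W (vertical t))))"
      using proj by meson
    then have "hdist x y = \<bar>ln (cmod (mob W (vertical s))) - ln (cmod (mob W (vertical t)))\<bar>"
      using \<tau>(1) by (simp add: geodesic_line_def)
    also have "\<dots> \<le> K"
      unfolding abcd K_def using \<open>b * c \<noteq> 0\<close> diagonal_nonzero[of a b c d] W abcd W_det
      by (intro ln_cmod_mob_vertical_diff) auto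
    finally show "ereal (hdist x y) \<le> ereal K" by simp
  qed
  also have "\<dots> < ereal L" using \<open>K < L\<close> by simp
  finally show ?thesis .
qed

end
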